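(* Let $l_0,l_1,l_2$ be pairwise coprime integers with $1\le l_0\le l_1\le l_2$, and let $\mathbb{P}=\mathbb{P}(l_0,l_1,l_2)$. If $d\ge l_0l_1l_2+l_0l_1+2l_2$, then a generic foliation with normal $\mathbb{Q}$-bundle of degree $d$ on $\mathbb{P}$ does not admit any invariant algebraic curve; that is, the set of $\mathcal{F}\in\mathsf{Fol}(d)$ admitting some invariant algebraic curve is contained in a countable union of proper Zariski-closed subsets of $\mathsf{Fol}(d)$.
   Context: $\mathbb{P}(l_0,l_1,l_2)$ is the quotient of $\mathbb{C}^3\setminus\{0\}$ by the $\mathbb{C}^*$-action $t\cdot(x_0,x_1,x_2)=(t^{l_0}x_0,t^{l_1}x_1,t^{l_2}x_2)$; points are written $[x_0:x_1:x_2]$. A polynomial is quasi-homogeneous of degree $n$ if it is a linear combination of monomials $x_0^{a}x_1^{b}x_2^{c}$ with $l_0a+l_1b+l_2c=n$. Let $R=l_0x_0\partial_{x_0}+l_1x_1\partial_{x_1}+l_2x_2\partial_{x_2}$. $\mathsf{Fol}(d)$ is the projectivization of the complex vector space of polynomial 1-forms $\omega=A_0dx_0+A_1dx_1+A_2dx_2$ with $A_i$ quasi-homogeneous of degree $d-l_i$ and $i_R\omega=0$; its elements $[\omega]$ are the foliations with normal $\mathbb{Q}$-bundle of degree $d$ on $\mathbb{P}$. An algebraic curve $C\subset\mathbb{P}$ of degree $n$ is the zero set of a nonconstant quasi-homogeneous polynomial $F$ of degree $n$; it is invariant by $\mathcal{F}=[\omega]$ if there is a polynomial 2-form $\Theta$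 with $\omega\wedge dF=F\,\Theta$ (equivalently, every irreducible component is invariant). *)

theory Defs
  imports Main "HOL.Complex"
begin

text \<open>Polynomials in x0,x1,x2 over the complex numbers, represented by their
coefficient functions on exponent triples (a,b,c) (monomial x0^a x1^b x2^c).
Genuine polynomials are those with finite support.\<close>

type_synonym cpoly = "nat \<times> nat \<times> nat \<Rightarrow> complex"

definition is_poly :: "cpoly \<Rightarrow> bool" where
  "is_poly p \<longleftrightarrow> finite {e. p e \<noteq> 0}"

definition wdeg :: "nat \<Rightarrow> nat \<Rightarrow> nat \<Rightarrow> nat \<times> nat \<times> nat \<Rightarrow> nat" where
  "wdeg l0 l1 l2 e = (case e of (a, b, c) \<Rightarrow> l0 * a + l1 * b + l2 * c)"

text \<open>quasi-homogeneous of (integer) degree n for the weights l0,l1,l2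
(the zero polynomial is quasi-homogeneous of every degree)\<close>
definition quasi_hom :: "nat \<Rightarrow> nat \<Rightarrow> nat \<Rightarrow> int \<Rightarrow> cpoly \<Rightarrow> bool" where
  "quasi_hom l0 l1 l2 n p \<longleftrightarrow> is_poly p \<and> (\<forall>e. p e \<noteq> 0 \<longrightarrow> int (wdeg l0 l1 l2 e) = n)"

definition padd :: "cpoly \<Rightarrow> cpoly \<Rightarrow> cpoly" where
  "padd p q = (\<lambda>e. p e + q e)"

definition psub :: "cpoly \<Rightarrow> cpoly \<Rightarrow> cpoly" where
  "psub p q = (\<lambda>e. p e - q e)"

definition pscale :: "complex \<Rightarrow> cpoly \<Rightarrow> cpoly" where
  "pscale c p = (\<lambda>e. c * p e)"

definition pmul :: "cpoly \<Rightarrow> cpoly \<Rightarrow> cpoly" where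
  "pmul p q = (\<lambda>(a, b, c). \<Sum>(i, j, k) \<in> {0..a} \<times> {0..b} \<times> {0..c}.
                 p (i, j, k) * q (a - i, b - j, c - k))"

definition mulx0 :: "cpoly \<Rightarrow> cpoly" where
  "mulx0 p = (\<lambda>(a, b, c). if a = 0 then 0 else p (a - 1, b, c))"
definition mulx1 :: "cpoly \<Rightarrow> cpoly" where
  "mulx1 p = (\<lambda>(a, b, c). if b = 0 then 0 else p (a, b - 1, c))"
definition mulx2 :: "cpoly \<Rightarrow> cpoly" where
  "mulx2 p = (\<lambda>(a, b, c). if c = 0 then 0 else p (a, b, c - 1))"

definition dx0 :: "cpoly \<Rightarrow> cpoly" where
  "dx0 p = (\<lambda>(a, b, c). of_nat (a + 1) * p (a + 1, b, c))"
definition dx1 :: "cpoly \<Rightarrow> cpoly" where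
  "dx1 p = (\<lambda>(a, b, c). of_nat (b + 1) * p (a, b + 1, c))"
definition dx2 :: "cpoly \<Rightarrow> cpoly" where
  "dx2 p = (\<lambda>(a, b, c). of_nat (c + 1) * p (a, b, c + 1))"

text \<open>A polynomial 1-form A0 dx0 + A1 dx1 + A2 dx2, as the triple (A0, A1, A2).\<close>
type_synonym form1 = "cpoly \<times> cpoly \<times> cpoly"

definition comp :: "nat \<Rightarrow> form1 \<Rightarrow> cpoly" where
  "comp i \<omega> = (if i = 0 then fst \<omega> else if i = 1 then fst (snd \<omega>) else snd (snd \<omega>))"

definition fscale :: "complex \<Rightarrow> form1 \<Rightarrow> form1" where
  "fscale c \<omega> = (pscale c (fst \<omega>), pscale c (fst (snd \<omega>)), pscale c (snd (snd \<omega>)))"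

text \<open>contraction with the weighted Euler field R = sum l_i x_i d/dx_i\<close>
definition contrR :: "nat \<Rightarrow> nat \<Rightarrow> nat \<Rightarrow> form1 \<Rightarrow> cpoly" where
  "contrR l0 l1 l2 \<omega> =
     padd (pscale (of_nat l0) (mulx0 (comp 0 \<omega>)))
      (padd (pscale (of_nat l1) (mulx1 (comp 1 \<omega>))) (pscale (of_nat l2) (mulx2 (comp 2 \<omega>))))"

text \<open>The vector space whose projectivization is Fol(d).\<close>
definition FolSpace :: "nat \<Rightarrow> nat \<Rightarrow> nat \<Rightarrow> int \<Rightarrow> form1 set" where
  "FolSpace l0 l1 l2 d = {\<omega>.
      quasi_hom l0 l1 l2 (d - int l0) (comp 0 \<omega>) \<and>
      quasi_hom l0 l1 l2 (d - int l1) (comp 1 \<omega>) \<and>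
      quasi_hom l0 l1 l2 (d - int l2) (comp 2 \<omega>) \<and>
      contrR l0 l1 l2 \<omega> = (\<lambda>_. 0)}"

text \<open>Invariance of the curve {F = 0} by [omega]: omega wedge dF = F Theta for a
polynomial 2-form Theta = T01 dx0^dx1 + T02 dx0^dx2 + T12 dx1^dx2.
(omega wedge dF has dx_i^dx_j coefficient A_i dF/dx_j - A_j dF/dx_i.)\<close>
definition invariant_curve :: "form1 \<Rightarrow> cpoly \<Rightarrow> bool" where
  "invariant_curve \<omega> F \<longleftrightarrow>
     (\<exists>T01 T02 T12. is_poly T01 \<and> is_poly T02 \<and> is_poly T12 \<and>
        psub (pmul (comp 0 \<omega>) (dx1 F)) (pmul (comp 1 \<omega>) (dx0 F)) = pmul F T01 \<and>
        psub (pmul (comp 0 \<omega>) (dx2 F)) (pmul (comp 2 \<omega>) (dx0 F)) = pmul F T02 \<and>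
        psub (pmul (comp 1 \<omega>) (dx2 F)) (pmul (comp 2 \<omega>) (dx1 F)) = pmul F T12)"

definition admits_invariant_curve :: "nat \<Rightarrow> nat \<Rightarrow> nat \<Rightarrow> form1 \<Rightarrow> bool" where
  "admits_invariant_curve l0 l1 l2 \<omega> \<longleftrightarrow>
     (\<exists>(n::nat) F. n > 0 \<and> quasi_hom l0 l1 l2 (int n) F \<and> F \<noteq> (\<lambda>_. 0) \<and>
        invariant_curve \<omega> F)"

inductive_set polyfun :: "(form1 \<Rightarrow> complex) set" where
  pf_const: "(\<lambda>_. c) \<in> polyfun"
| pf_coord: "(\<lambda>\<omega>. comp i \<omega> e) \<in> polyfun"
| pf_add: "f \<in> polyfun \<Longrightarrow> g \<in> polyfun \<Longrightarrow> (\<lambda>\<omega>. f \<omega> + g \<omega>) \<in> polyfun"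
| pf_mul: "f \<in> polyfun \<Longrightarrow> g \<in> polyfun \<Longrightarrow> (\<lambda>\<omega>. f \<omega> * g \<omega>) \<in> polyfun"

text \<open>Zariski-closed subsets of the projectivization P(V) of V are represented by their
affine cones: Zariski-closed subsets of V stable under scalar multiplication.
The subset of P(V) is proper iff some nonzero vector of V lies outside the cone.\<close>
definition zariski_closed_cone :: "form1 set \<Rightarrow> form1 set \<Rightarrow> bool" where
  "zariski_closed_cone V S \<longleftrightarrow>
     (\<exists>P \<subseteq> polyfun. S = {\<omega> \<in> V. \<forall>f \<in> P. f \<omega> = 0}) \<and>
     (\<forall>c \<omega>. \<omega> \<in> S \<longrightarrow> fscale c \<omega> \<in> S)"

definition proper_in_proj :: "form1 set \<Rightarrow> form1 set \<Rightarrow> bool" where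
  "proper_in_proj V S \<longleftrightarrow> (\<exists>\<omega> \<in> V. \<omega> \<noteq> (\<lambda>_. 0, \<lambda>_. 0, \<lambda>_. 0) \<and> \<omega> \<notin> S)"

end

theory Submission
  imports Defs
    "HOL-Computational_Algebra.Formal_Power_Series"
    "HOL-Computational_Algebra.Fundamental_Theorem_Algebra"
    "HOL-Analysis.Continuum_Not_Denumerable"
    "HOL-Library.Countable"
begin

text \<open>After rescaling, a form outside countably many proper closed cones is a zero of no integer
  polynomial in the coefficients unless this polynomial vanishes on the whole space. Its coefficients can then be
  specialized to those of any other form, the specialization extends to a place of \<open>\<complex>\<close>, and by
  Gauss's lemma an invariant curve of the generic form reduces to an invariant curve of the special
  one. So it suffices to find a single form without invariant curves.

  Such a form comes from the vector field \<open>D0 + \<epsilon> x1^u x2^v \<partial>0\<close> with \<open>\<epsilon>\<close> transcendental, where \<open>D0\<close>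
  is chosen such that \<open>x0 = 0\<close> is its only irreducible invariant curve, as seen from the leading
  terms of \<open>F\<close> and of its cofactor for three weights. Reducing modulo a place with \<open>\<epsilon> \<mapsto> 0\<close>, an
  invariant curve of the perturbed field becomes \<open>x0^K\<close>; the terms of first order in the
  deviation from \<open>x0^K\<close> and in \<open>\<epsilon>\<close> then contradict the choice of \<open>u\<close> and \<open>v\<close>.\<close>

text \<open>For a fixed degree, properness of the projective space of curves would make the set of
  forms with an invariant curve of that degree closed. Places replace this geometry and treat all
  degrees at once: dividing the coefficients of a curve by the one of largest value makes the curve
  finite at the place with nonzero reduction, as in the valuative criterion of properness.

  The obstacle is to exhibit one form without invariant curves. Comparing leading terms works well
  for a field without \<open>\<partial>0\<close>-component, but every such field leaves the line x0
  = 0 invariant, so a perturbation is unavoidable. The size of \<epsilon> relative to the deviation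
  of a curve from x0^K is unknown; both are therefore divided by whichever number dominates, so that
  their two reductions cannot both vanish.

  The lower bound on d serves to find exponents that satisfy all positivity, order and divisibility
  conditions for arbitrary coprime weights.\<close>

section \<open>Places of the complex numbers\<close>

text \<open>A ring homomorphism from a subring of \<open>\<complex>\<close> to \<open>\<complex>\<close>, represented by its graph.\<close>

definition partial_hom :: "(complex \<times> complex) set \<Rightarrow> bool" where
  "partial_hom R \<longleftrightarrow> (1, 1) \<in> R \<and>
     (\<forall>a b c d. (a, b) \<in> R \<longrightarrow> (c, d) \<in> R \<longrightarrow> (a - c, b - d) \<in> R \<and> (a * c, b * d) \<in> R) \<and>
     (\<forall>b. (0, b) \<in> R \<longrightarrow> b = 0)"

lemma partial_hom_one: "partial_hom R \<Longrightarrow> (1, 1) \<in> R"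
  and partial_hom_diff: "partial_hom R \<Longrightarrow> (a, b) \<in> R \<Longrightarrow> (c, d) \<in> R \<Longrightarrow> (a - c, b - d) \<in> R"
  and partial_hom_mult: "partial_hom R \<Longrightarrow> (a, b) \<in> R \<Longrightarrow> (c, d) \<in> R \<Longrightarrow> (a * c, b * d) \<in> R"
  and partial_hom_0D: "partial_hom R \<Longrightarrow> (0, b) \<in> R \<Longrightarrow> b = 0"
  unfolding partial_hom_def by blast+

lemma partial_hom_zero: "partial_hom R \<Longrightarrow> (0, 0) \<in> R"
  using partial_hom_diff[OF _ partial_hom_one partial_hom_one] by force

lemma partial_hom_add:
  assumes "partial_hom R" "(a, b) \<in> R" "(c, d) \<in> R" shows "(a + c, b + d) \<in> R"
  using partial_hom_diff[OF assms(1,2) partial_hom_diff[OF assms(1) partial_hom_zero[OF assms(1)] assms(3)]]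
  by simp

lemma partial_hom_sum:
  assumes "partial_hom R" "\<And>i. i \<in> I \<Longrightarrow> (f i, g i) \<in> R"
  shows "(sum f I, sum g I) \<in> R"
  using assms(2) by (induction I rule: infinite_finite_induct)
    (auto intro: partial_hom_zero partial_hom_add assms(1))

lemma partial_hom_power:
  assumes "partial_hom R" "(a, b) \<in> R" shows "(a ^ n, b ^ n) \<in> R"
  by (induction n) (auto intro: partial_hom_one partial_hom_mult assms)

lemma partial_hom_of_nat:
  assumes "partial_hom R" shows "(of_nat n, of_nat n) \<in> R"
  by (induction n) (auto intro: partial_hom_zero partial_hom_one partial_hom_add assms)

lemma partial_hom_unique:
  assumes "partial_hom R" "(a, b) \<in> R" "(a, c) \<in> R" shows "b = c"
  using partial_hom_0D[OF assms(1), of "b - c"] partial_hom_diff[OF assms] by simp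

lemma poly_eq_sum_upto:
  fixes p :: "'a::comm_semiring_1 poly"
  assumes "degree p \<le> n" shows "poly p x = (\<Sum>i\<le>n. coeff p i * x ^ i)"
  unfolding poly_altdef using assms
  by (intro sum.mono_neutral_left) (auto simp: coeff_eq_0)

definition paired :: "(complex \<times> complex) set \<Rightarrow> complex poly \<Rightarrow> complex poly \<Rightarrow> bool" where
  "paired R p q \<longleftrightarrow> (\<forall>i. (coeff p i, coeff q i) \<in> R)"

lemma paired_diff: "partial_hom R \<Longrightarrow> paired R p q \<Longrightarrow> paired R p' q' \<Longrightarrow> paired R (p - p') (q - q')"
  by (simp add: paired_def partial_hom_diff)

lemma paired_mult: "partial_hom R \<Longrightarrow> paired R p q \<Longrightarrow> paired R p' q' \<Longrightarrow> paired R (p * p') (q * q')"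
  by (simp add: paired_def coeff_mult partial_hom_sum partial_hom_mult)

lemma paired_monom: "partial_hom R \<Longrightarrow> (a, b) \<in> R \<Longrightarrow> paired R (monom a n) (monom b n)"
  by (simp add: paired_def partial_hom_zero)

section \<open>Maximal homomorphisms and the valuation property\<close>

text \<open>The graphs of the places of \<open>\<complex>\<close>.\<close>

definition max_hom :: "(complex \<times> complex) set \<Rightarrow> bool" where
  "max_hom R \<longleftrightarrow> partial_hom R \<and> (\<forall>R'. partial_hom R' \<longrightarrow> R \<subseteq> R' \<longrightarrow> R' = R)"

lemma partial_hom_Union:
  assumes "C \<noteq> {}" "\<And>R. R \<in> C \<Longrightarrow> partial_hom R" "\<And>R S. R \<in> C \<Longrightarrow> S \<in> C \<Longrightarrow> R \<subseteq> S \<or> S \<subseteq> R"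
  shows "partial_hom (\<Union>C)"
  unfolding partial_hom_def
proof (intro conjI allI impI)
  show "(1, 1) \<in> \<Union>C" using assms partial_hom_one by fastforce
  show "b = 0" if "(0, b) \<in> \<Union>C" for b using that assms(2) partial_hom_0D by blast
  fix a b c d assume "(a, b) \<in> \<Union>C" "(c, d) \<in> \<Union>C"
  then obtain R where "R \<in> C" "(a, b) \<in> R" "(c, d) \<in> R" using assms(3) by blast
  then show "(a - c, b - d) \<in> \<Union>C" "(a * c, b * d) \<in> \<Union>C"
    using assms(2) partial_hom_diff partial_hom_mult by blast+
qed

lemma ex_max_hom:
  assumes "partial_hom R0"
  shows "\<exists>R. R0 \<subseteq> R \<and> max_hom R"
proof -
  have "\<exists>M\<in>{R. partial_hom R \<and> R0 \<subseteq> R}. \<forall>X\<in>{R. partial_hom R \<and> R0 \<subseteq> R}. M \<subseteq> X \<longrightarrow> X = M"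
  proof (rule subset_Zorn_nonempty)
    show "{R. partial_hom R \<and> R0 \<subseteq> R} \<noteq> {}" using assms by blast
    fix C assume C: "C \<noteq> {}" "subset.chain {R. partial_hom R \<and> R0 \<subseteq> R} C"
    then have "partial_hom (\<Union>C)"
      by (intro partial_hom_Union) (auto simp: subset_chain_def)
    moreover obtain R where "R \<in> C" using C(1) by blast
    then have "R0 \<subseteq> \<Union>C" using C(2) by (auto simp: subset_chain_def)
    ultimately show "\<Union>C \<in> {R. partial_hom R \<and> R0 \<subseteq> R}" by simp
  qed
  then obtain M where M: "partial_hom M" "R0 \<subseteq> M"
    and max: "\<forall>X\<in>{R. partial_hom R \<and> R0 \<subseteq> R}. M \<subseteq> X \<longrightarrow> X = M" by blast
  have "max_hom M"
    unfolding max_hom_def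
  proof (intro conjI allI impI)
    fix R' assume R': "partial_hom R'" "M \<subseteq> R'"
    then have "R' \<in> {R. partial_hom R \<and> R0 \<subseteq> R}" using M(2) by simp
    then show "R' = M" using max R'(2) by blast
  qed (fact M(1))
  with M(2) show ?thesis by blast
qed

lemma max_hom_imp_partial_hom: "max_hom R \<Longrightarrow> partial_hom R"
  by (simp add: max_hom_def)

text \<open>The assumption makes x \<mapsto> t a well-defined extension to the ring generated by x:
  two polynomial expressions of one element differ by a relation, and its reduction vanishes at t.
  Maximality then puts the pair into \<open>R\<close> already.\<close>

lemma max_hom_adjoin:
  assumes R: "max_hom R"
    and single: "\<And>p q. paired R p q \<Longrightarrow> poly p x = 0 \<Longrightarrow> poly q t = 0"
  shows "(x, t) \<in> R"
proof -
  note h = max_hom_imp_partial_hom[OF R]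
  define R' where "R' = {(poly p x, poly q t) | p q. paired R p q}"
  have "partial_hom R'"
    unfolding partial_hom_def
  proof (intro conjI allI impI)
    have "paired R 1 1" using paired_monom[OF h partial_hom_one[OF h], of 0] by simp
    then show "(1, 1) \<in> R'" by (force simp: R'_def)
    fix a b c d assume "(a, b) \<in> R'" "(c, d) \<in> R'"
    then show "(a - c, b - d) \<in> R'" "(a * c, b * d) \<in> R'"
      by (force simp: R'_def intro: paired_diff[OF h] paired_mult[OF h] simp flip: poly_mult poly_diff)+
  qed (use single in \<open>auto simp: R'_def\<close>)
  moreover have "R \<subseteq> R'"
  proof clarify
    fix a b assume "(a, b) \<in> R"
    then have "paired R [:a:] [:b:]" using paired_monom[OF h, of a b 0] by (simp add: monom_0)
    then show "(a, b) \<in> R'" by (force simp: R'_def)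
  qed
  moreover have "(x, t) \<in> R'"
    using paired_monom[OF h partial_hom_one[OF h], of 1] by (force simp: R'_def poly_monom)
  ultimately show ?thesis using R unfolding max_hom_def by blast
qed

lemma poly_reflect_inverse:
  fixes x :: complex assumes "x \<noteq> 0"
  shows "(\<Sum>i\<le>n. coeff p i * x ^ (n - i)) = x ^ n * (\<Sum>i\<le>n. coeff p i * inverse x ^ i)"
  unfolding sum_distrib_left
proof (rule sum.cong)
  fix i assume "i \<in> {..n}"
  then have "x ^ n = x ^ (n - i) * x ^ i" by (simp flip: power_add)
  then show "coeff p i * x ^ (n - i) = x ^ n * (coeff p i * inverse x ^ i)"
    using assms by (simp add: field_simps)
qed simp

text \<open>The domain of a place is a local ring: a relation for \<open>inverse a\<close>,
  multiplied by \<open>a ^ n\<close>, becomes an identity inside the domain, and reducing it gives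
  the relation for \<open>inverse b\<close>.\<close>

lemma max_hom_inverse:
  assumes R: "max_hom R" and ab: "(a, b) \<in> R" "b \<noteq> 0"
  shows "(inverse a, inverse b) \<in> R"
proof (rule max_hom_adjoin[OF R])
  note h = max_hom_imp_partial_hom[OF R]
  have "a \<noteq> 0" using ab partial_hom_0D[OF h] by blast
  fix p q assume pq: "paired R p q" and 0: "poly p (inverse a) = 0"
  define n where "n = max (degree p) (degree q)"
  have eq: "poly p (inverse a) = (\<Sum>i\<le>n. coeff p i * inverse a ^ i)"
    "poly q (inverse b) = (\<Sum>i\<le>n. coeff q i * inverse b ^ i)"
    by (auto simp: n_def intro!: poly_eq_sum_upto)
  have "(\<Sum>i\<le>n. coeff p i * a ^ (n - i), \<Sum>i\<le>n. coeff q i * b ^ (n - i)) \<in> R"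
    using pq ab by (auto simp: paired_def intro!: partial_hom_sum partial_hom_mult partial_hom_power h)
  then have "(0, b ^ n * poly q (inverse b)) \<in> R"
    using 0 eq ab(2) \<open>a \<noteq> 0\<close> by (simp add: poly_reflect_inverse)
  from partial_hom_0D[OF h this] show "poly q (inverse b) = 0" using ab(2) by simp
qed

text \<open>The ideal of all reductions of relations satisfied by \<open>x\<close> has no zero in \<open>\<complex>\<close>, hence is the
  unit ideal by the fundamental theorem of algebra.\<close>

lemma max_hom_relation:
  assumes R: "max_hom R" and x: "\<And>t. (x, t) \<notin> R"
  shows "\<exists>p. paired R p 1 \<and> poly p x = 0"
proof -
  note h = max_hom_imp_partial_hom[OF R]
  define I where "I q \<longleftrightarrow> (\<exists>p. paired R p q \<and> poly p x = 0)" for q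
  have nz: "\<exists>q. I q \<and> poly q t \<noteq> 0" for t
    using max_hom_adjoin[OF R] x unfolding I_def by metis
  obtain q where q: "I q" "q \<noteq> 0" and qmin: "\<And>r. I r \<Longrightarrow> r \<noteq> 0 \<Longrightarrow> degree q \<le> degree r"
    using ex_has_least_nat[of "\<lambda>q. I q \<and> q \<noteq> 0" _ degree] nz by (metis poly_0)
  obtain p where p: "paired R p q" "poly p x = 0" using q(1) by (auto simp: I_def)
  \<comment> \<open>The values of the place form a field, so division by \<open>q\<close> does not
    leave the ideal \<open>I\<close>.\<close>
  have lc: "(inverse (coeff p (degree q)), inverse (lead_coeff q)) \<in> R"
    using p(1) q(2) by (intro max_hom_inverse[OF R]) (auto simp: paired_def)
  have "degree q = 0"
  proof (rule ccontr)
    assume "degree q \<noteq> 0"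
    then have "\<not> constant (poly q)" by (simp add: constant_degree)
    then obtain t where t: "poly q t = 0"
      using fundamental_theorem_of_algebra by blast
    \<comment> \<open>Such an \<open>r\<close> exists because \<open>I\<close> has no common zero.
      Subtracting a multiple of \<open>q\<close> keeps its value at \<open>t\<close> but can lower
      its degree.\<close>
    obtain r where r: "I r" "poly r t \<noteq> 0"
      and rmin: "\<And>r'. I r' \<Longrightarrow> poly r' t \<noteq> 0 \<Longrightarrow> degree r \<le> degree r'"
      using ex_has_least_nat[of "\<lambda>q. I q \<and> poly q t \<noteq> 0" _ degree] nz by metis
    obtain p' where p': "paired R p' r" "poly p' x = 0" using r(1) by (auto simp: I_def)
    have deg: "degree q \<le> degree r" using qmin r by force
    define j where "j = degree r - degree q"
    define u where "u = monom (coeff p' (degree r) * inverse (coeff p (degree q))) j"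
    define v where "v = monom (lead_coeff r * inverse (lead_coeff q)) j"
    have "paired R u v"
      unfolding u_def v_def using p'(1)
      by (intro paired_monom[OF h] partial_hom_mult[OF h] lc) (auto simp: paired_def)
    then have "I (r - v * q)"
      unfolding I_def using p p'
      by (intro exI[of _ "p' - u * p"]) (auto intro: paired_diff paired_mult h)
    moreover have "poly (r - v * q) t \<noteq> 0" using t r by simp
    moreover have "degree (r - v * q) < degree r"
    proof (rule degree_lessI)
      have "degree (v * q) \<le> degree r"
        using degree_mult_le[of v q] degree_monom_le[of _ j] deg
        by (metis (no_types, lifting) add.commute add_le_cancel_left j_def le_add_diff_inverse le_trans v_def)
      then show "\<forall>k\<ge>degree r. coeff (r - v * q) k = 0"
      proof (intro allI impI)
        fix k assume k: "degree r \<le> k"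
        have "coeff (v * q) k = lead_coeff r * inverse (lead_coeff q) * coeff q (k - j)"
          using k by (simp add: v_def coeff_monom_mult j_def)
        moreover have "coeff q (k - j) = 0" if "k > degree r"
          using that deg by (intro coeff_eq_0) (auto simp: j_def)
        moreover have "coeff r k = 0" if "k > degree r" using that by (rule coeff_eq_0)
        moreover have "degree r - j = degree q" using deg by (simp add: j_def)
        ultimately show "coeff (r - v * q) k = 0" using k q(2) by (cases "k = degree r") auto
      qed
    qed (use \<open>degree q \<noteq> 0\<close> deg in auto)
    ultimately show False using rmin by force
  qed
  define u where "u = monom (inverse (coeff p 0)) 0"
  have lc': "(inverse (coeff p 0), inverse (coeff q 0)) \<in> R" using lc \<open>degree q = 0\<close> by simp
  have "paired R (u * p) (monom (inverse (coeff q 0)) 0 * q)"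
    unfolding u_def by (intro paired_mult[OF h] paired_monom[OF h] lc' p)
  moreover have "monom (inverse (coeff q 0)) 0 * q = 1"
  proof -
    obtain c where c: "q = [:c:]" using \<open>degree q = 0\<close> degree_0_id by metis
    show ?thesis using q(2) by (simp add: c monom_0 one_pCons)
  qed
  ultimately show ?thesis using p(2) by (intro exI[of _ "u * p"]) auto
qed

text \<open>\<open>reflect_poly p'\<close> is a relation for x whose leading coefficient
  \<open>coeff p' 0\<close> is a unit, so a multiple of it cancels the leading term of
  \<open>p\<close>. The multiplier has value 0, as \<open>lead_coeff p\<close> has, so the
  difference still reduces to 1.\<close>

lemma max_hom_shorten_relation:
  assumes R: "max_hom R" and x: "x \<noteq> 0"
    and p: "paired R p 1" "poly p x = 0" and p': "paired R p' 1" "poly p' (inverse x) = 0"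
    and deg: "degree p' \<le> degree p"
  shows "\<exists>r. paired R r 1 \<and> poly r x = 0 \<and> degree r < degree p"
proof -
  note h = max_hom_imp_partial_hom[OF R]
  have c0: "(coeff p' 0, 1) \<in> R" using p'(1) by (auto simp: paired_def dest: spec[of _ 0])
  then have c0': "coeff p' 0 \<noteq> 0" using partial_hom_0D[OF h] by fastforce
  have i0: "(inverse (coeff p' 0), 1) \<in> R" using max_hom_inverse[OF R c0] by simp
  have pn: "degree p \<noteq> 0"
  proof
    assume "degree p = 0"
    then obtain c where "p = [:c:]" using degree_0_id by metis
    then have "p = 0" using p(2) by simp
    then show False using p(1) partial_hom_0D[OF h, of 1] by (auto simp: paired_def dest: spec[of _ 0])
  qed
  define j where "j = degree p - degree p'"
  define u where "u = monom (lead_coeff p * inverse (coeff p' 0)) j"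
  have lcp: "(lead_coeff p, 0) \<in> R" using p(1) pn by (auto simp: paired_def dest: spec[of _ "degree p"])
  have "(lead_coeff p * inverse (coeff p' 0), 0 * 1) \<in> R"
    by (rule partial_hom_mult[OF h lcp i0])
  then have "(lead_coeff p * inverse (coeff p' 0) * c, 0 * d) \<in> R" if "(c, d) \<in> R" for c d
    using partial_hom_mult[OF h _ that] by force
  moreover have "\<exists>d. (coeff (reflect_poly p') i, d) \<in> R" for i
    using p'(1) partial_hom_zero[OF h] by (auto simp: coeff_reflect_poly paired_def)
  ultimately have "paired R (u * reflect_poly p') 0"
    using partial_hom_zero[OF h] by (fastforce simp: paired_def u_def coeff_monom_mult)
  then have "paired R (p - u * reflect_poly p') (1 - 0)" by (intro paired_diff h p)
  moreover have "poly (reflect_poly p') x = 0"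
    using p'(2) x by (simp add: poly_reflect_poly_nz)
  moreover have "degree (p - u * reflect_poly p') < degree p"
  proof (rule degree_lessI)
    show "\<forall>k\<ge>degree p. coeff (p - u * reflect_poly p') k = 0"
    proof (intro allI impI)
      fix k assume k: "degree p \<le> k"
      have "coeff (u * reflect_poly p') k
          = lead_coeff p * inverse (coeff p' 0) * coeff (reflect_poly p') (k - j)"
        using k by (simp add: u_def coeff_monom_mult j_def)
      moreover have "coeff (reflect_poly p') (k - j) = 0" if "k > degree p"
        using that deg by (auto simp: j_def coeff_reflect_poly)
      moreover have "degree p - j = degree p'" using deg by (simp add: j_def)
      moreover have "coeff p k = 0" if "k > degree p" using that by (rule coeff_eq_0)
      ultimately show "coeff (p - u * reflect_poly p') k = 0"
        using k c0' by (cases "k = degree p") (auto simp: coeff_reflect_poly)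
    qed
  qed (use pn in auto)
  ultimately show ?thesis using p(2) by (intro exI[of _ "p - u * reflect_poly p'"]) auto
qed

text \<open>Chevalley's argument: if neither x nor its inverse were finite, both would satisfy
  relations reducing to 1, and of two relations of minimal degree the one of larger degree could be
  shortened. The value of \<open>inverse x\<close> is 0 since a nonzero value would make x
  finite.\<close>

theorem max_hom_valuation:
  assumes R: "max_hom R"
  shows "(\<exists>t. (x, t) \<in> R) \<or> (inverse x, 0) \<in> R"
proof (rule ccontr)
  assume *: "\<not> ?thesis"
  note h = max_hom_imp_partial_hom[OF R]
  have x0: "x \<noteq> 0" using * partial_hom_zero[OF h] by auto
  have inv: "(inverse x, t) \<notin> R" for t
  proof
    assume "(inverse x, t) \<in> R"
    moreover from this have "t \<noteq> 0" using * by auto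
    ultimately show False using max_hom_inverse[OF R] * by force
  qed
  define P where "P y p \<longleftrightarrow> paired R p 1 \<and> poly p y = 0" for y p
  obtain p where p: "P x p" and pmin: "\<And>r. P x r \<Longrightarrow> degree p \<le> degree r"
    using max_hom_relation[OF R, of x] ex_has_least_nat[of "P x" _ degree] * unfolding P_def by metis
  obtain p' where p': "P (inverse x) p'" and p'min: "\<And>r. P (inverse x) r \<Longrightarrow> degree p' \<le> degree r"
    using max_hom_relation[OF R, of "inverse x"] ex_has_least_nat[of "P (inverse x)" _ degree] inv
    unfolding P_def by metis
  show False
  proof (cases "degree p' \<le> degree p")
    case True
    then show False
      using max_hom_shorten_relation[OF R x0, of p p'] p p' pmin unfolding P_def by force
  next
    case False
    then show False
      using max_hom_shorten_relation[OF R, of "inverse x" p' p] x0 p p' p'min unfolding P_def by force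
  qed
qed

text \<open>\<open>\<mu>\<close> is an element of largest value; it exists because of any two
  nonzero numbers one is a finite multiple of the other.\<close>

lemma max_hom_normalize:
  assumes R: "max_hom R" and "finite S" "\<exists>x\<in>S. x \<noteq> 0"
  shows "\<exists>\<mu>\<in>S. \<mu> \<noteq> 0 \<and> (\<forall>x\<in>S. \<exists>t. (x / \<mu>, t) \<in> R)"
proof -
  note h = max_hom_imp_partial_hom[OF R]
  have "\<exists>\<mu>\<in>S. \<mu> \<noteq> 0 \<and> (\<forall>x\<in>S. \<exists>t. (x / \<mu>, t) \<in> R)" if "finite S" "S \<noteq> {}" "0 \<notin> S" for S
    using that
  proof (induction rule: finite_ne_induct)
    case (singleton x)
    then show ?case using partial_hom_one[OF h] by auto
  next
    case (insert y S)
    then obtain \<mu> where \<mu>: "\<mu> \<in> S" "\<mu> \<noteq> 0" "\<forall>x\<in>S. \<exists>t. (x / \<mu>, t) \<in> R" by auto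
    show ?case
    proof (cases "\<exists>t. (y / \<mu>, t) \<in> R")
      case True
      then show ?thesis using \<mu> by (intro bexI[of _ \<mu>]) auto
    next
      case False
      then have "(inverse (y / \<mu>), 0) \<in> R" using max_hom_valuation[OF R] by blast
      then have \<mu>y: "(\<mu> / y, 0) \<in> R" by (simp add: divide_inverse mult.commute)
      have "\<exists>t. (x / y, t) \<in> R" if xS: "x \<in> S" for x
      proof -
        obtain t where "(x / \<mu>, t) \<in> R" using \<mu> xS by blast
        from partial_hom_mult[OF h this \<mu>y] show ?thesis using \<mu>(2) by auto
      qed
      then show ?thesis using insert.prems partial_hom_one[OF h] by (intro bexI[of _ y]) auto
    qed
  qed
  from this[of "S - {0}"] obtain \<mu> where "\<mu> \<in> S" "\<mu> \<noteq> 0" "\<forall>x\<in>S - {0}. \<exists>t. (x / \<mu>, t) \<in> R"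
    using assms by auto
  then show ?thesis using partial_hom_zero[OF h] by (intro bexI[of _ \<mu>]) auto
qed

section \<open>The ring of coefficient functions\<close>

text \<open>With \<open>pmul\<close>, all coefficient functions form the power series ring in three variables; this
  makes the commutative ring laws and the absence of zero divisors available.\<close>

unbundle fps_syntax

definition fps3 :: "cpoly \<Rightarrow> complex fps fps fps" where
  "fps3 F = Abs_fps (\<lambda>a. Abs_fps (\<lambda>b. Abs_fps (\<lambda>c. F (a, b, c))))"

lemma fps3_nth [simp]: "fps3 F $ a $ b $ c = F (a, b, c)"
  by (simp add: fps3_def)

lemma fps3_eqI: "(\<And>a b c. f $ a $ b $ c = g $ a $ b $ c) \<Longrightarrow> f = (g :: complex fps fps fps)"
  by (intro fps_ext) auto

lemma fps3_inject: "fps3 F = fps3 G \<longleftrightarrow> F = G"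
proof
  assume *: "fps3 F = fps3 G"
  have "F (a, b, c) = G (a, b, c)" for a b c
    using arg_cong[OF *, of "\<lambda>f. f $ a $ b $ c"] by simp
  then show "F = G" by auto
qed simp

abbreviation fps3_const :: "complex \<Rightarrow> complex fps fps fps" where
  "fps3_const c \<equiv> fps_const (fps_const (fps_const c))"

lemma pmul_nested:
  "pmul F G (a, b, c)
     = (\<Sum>i=0..a. \<Sum>j=0..b. \<Sum>k=0..c. F (i, j, k) * G (a - i, b - j, c - k))"
  by (simp add: pmul_def sum.cartesian_product[symmetric])

lemma fps3_pmul: "fps3 (pmul F G) = fps3 F * fps3 G"
  by (rule fps3_eqI) (simp add: pmul_nested fps_mult_nth fps_sum_nth)

lemma fps3_padd: "fps3 (padd F G) = fps3 F + fps3 G"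
  by (rule fps3_eqI) (simp add: padd_def)

lemma fps3_psub: "fps3 (psub F G) = fps3 F - fps3 G"
  by (rule fps3_eqI) (simp add: psub_def)

lemma fps3_pscale: "fps3 (pscale k F) = fps3_const k * fps3 F"
  by (rule fps3_eqI) (simp add: pscale_def)

lemma fps3_mulx0: "fps3 (mulx0 F) = fps_X * fps3 F"
  by (rule fps3_eqI) (simp add: mulx0_def)

lemma fps3_mulx1: "fps3 (mulx1 F) = fps_const fps_X * fps3 F"
  by (rule fps3_eqI) (simp add: mulx1_def)

lemma fps3_mulx2: "fps3 (mulx2 F) = fps_const (fps_const fps_X) * fps3 F"
  by (rule fps3_eqI) (simp add: mulx2_def)

lemma fps3_zero: "fps3 (\<lambda>_. 0) = 0"
  by (rule fps3_eqI) simp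

lemmas fps3_simps = fps3_pmul fps3_padd fps3_psub fps3_pscale fps3_mulx0 fps3_mulx1 fps3_mulx2 fps3_zero

lemma pmul_commute: "pmul F G = pmul G F"
  by (simp add: fps3_pmul mult.commute flip: fps3_inject)

lemma pmul_eq_0_iff: "pmul F G = (\<lambda>_. 0) \<longleftrightarrow> F = (\<lambda>_. 0) \<or> G = (\<lambda>_. 0)"
  by (simp add: fps3_simps flip: fps3_inject)

definition monomial :: "nat \<times> nat \<times> nat \<Rightarrow> cpoly" where
  "monomial u = (\<lambda>e. if e = u then 1 else 0)"

lemma pmul_monomial:
  "pmul (monomial (u0, u1, u2)) G (a, b, c)
     = (if u0 \<le> a \<and> u1 \<le> b \<and> u2 \<le> c then G (a - u0, b - u1, c - u2) else 0)"
proof -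
  have "pmul (monomial (u0, u1, u2)) G (a, b, c)
      = (\<Sum>x\<in>{0..a} \<times> {0..b} \<times> {0..c}. if x = (u0, u1, u2) then G (a - u0, b - u1, c - u2) else 0)"
    unfolding pmul_def monomial_def prod.case by (intro sum.cong) (auto split: if_splits)
  then show ?thesis by (simp add: sum.delta)
qed

lemma pmul_padd_left: "pmul (padd F G) H = padd (pmul F H) (pmul G H)"
  by (simp add: fps3_simps algebra_simps flip: fps3_inject)

lemma pmul_psub_right: "pmul F (psub G H) = psub (pmul F G) (pmul F H)"
  by (simp add: fps3_simps algebra_simps flip: fps3_inject)

lemma pmul_pscale_left: "pmul (pscale k F) G = pscale k (pmul F G)"
  by (simp add: fps3_simps algebra_simps flip: fps3_inject)

lemma pmul_pscale_right: "pmul F (pscale k G) = pscale k (pmul F G)"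
  by (simp add: fps3_simps algebra_simps flip: fps3_inject)

lemma is_poly_padd: "is_poly F \<Longrightarrow> is_poly G \<Longrightarrow> is_poly (padd F G)"
  unfolding is_poly_def padd_def by (rule finite_subset[of _ "{e. F e \<noteq> 0} \<union> {e. G e \<noteq> 0}"]) auto

lemma is_poly_psub: "is_poly F \<Longrightarrow> is_poly G \<Longrightarrow> is_poly (psub F G)"
  unfolding is_poly_def psub_def by (rule finite_subset[of _ "{e. F e \<noteq> 0} \<union> {e. G e \<noteq> 0}"]) auto

lemma is_poly_pscale: "is_poly F \<Longrightarrow> is_poly (pscale k F)"
  unfolding is_poly_def pscale_def by (rule finite_subset[of _ "{e. F e \<noteq> 0}"]) auto

lemma is_poly_monomial: "is_poly (monomial u)"
  by (simp add: is_poly_def monomial_def)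

section \<open>Leading terms of cofactors\<close>

definition weight :: "int \<Rightarrow> int \<Rightarrow> int \<Rightarrow> nat \<times> nat \<times> nat \<Rightarrow> int" where
  "weight n0 n1 n2 = (\<lambda>(a, b, c). n0 * int a + n1 * int b + n2 * int c)"

text \<open>A unique monomial of top weight in \<open>F\<close> excludes cancellation in the top
  weight of the product. So a bound on the product bounds the unknown factor \<open>L\<close>, and
  in the boundary weight each coefficient of the product comes from that one monomial; it is 0 where
  the exponent in \<open>L\<close> would be negative.\<close>

lemma pmul_leading_term:
  assumes L: "is_poly L" and Fe: "F (e0, e1, e2) \<noteq> 0"
    and e: "\<And>f. F f \<noteq> 0 \<Longrightarrow> f \<noteq> (e0, e1, e2) \<Longrightarrow> weight n0 n1 n2 f < weight n0 n1 n2 (e0, e1, e2)"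
    and supp: "\<And>h. pmul F L h \<noteq> 0 \<Longrightarrow> weight n0 n1 n2 h \<le> weight n0 n1 n2 (e0, e1, e2) + \<mu>"
  shows "L g \<noteq> 0 \<Longrightarrow> weight n0 n1 n2 g \<le> \<mu>" (is "_ \<Longrightarrow> ?w g \<le> \<mu>")
    and "weight n0 n1 n2 (a, b, c) = weight n0 n1 n2 (e0, e1, e2) + \<mu> \<Longrightarrow> pmul F L (a, b, c)
      = (if e0 \<le> a \<and> e1 \<le> b \<and> e2 \<le> c then F (e0, e1, e2) * L (a - e0, b - e1, c - e2) else 0)"
proof -
  let ?e = "(e0, e1, e2)"
  \<comment> \<open>The bound \<nu> is kept free: it is first the exact maximal weight of
    \<open>L\<close>, in order to show \<nu> \<le> \<mu>, and then \<mu> itself.\<close>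
  have key: "pmul F L (a, b, c)
      = (if e0 \<le> a \<and> e1 \<le> b \<and> e2 \<le> c then F ?e * L (a - e0, b - e1, c - e2) else 0)"
    if w: "?w (a, b, c) \<ge> ?w ?e + \<nu>" and \<nu>: "\<And>g. L g \<noteq> 0 \<Longrightarrow> ?w g \<le> \<nu>" for a b c \<nu>
  proof -
    have 0: "F (i, j, k) * L (a - i, b - j, c - k) = 0"
      if "i \<le> a" "j \<le> b" "k \<le> c" "(i, j, k) \<noteq> ?e" for i j k
    proof (rule ccontr)
      assume "\<not> ?thesis"
      then have "F (i, j, k) \<noteq> 0" "L (a - i, b - j, c - k) \<noteq> 0" by auto
      then have "?w (i, j, k) < ?w ?e" "?w (a - i, b - j, c - k) \<le> \<nu>" using e \<nu> that by auto
      moreover have "?w (a, b, c) = ?w (i, j, k) + ?w (a - i, b - j, c - k)"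
        using that by (simp add: weight_def of_nat_diff algebra_simps)
      ultimately show False using w by linarith
    qed
    have "pmul F L (a, b, c) = (\<Sum>x\<in>{0..a} \<times> {0..b} \<times> {0..c}.
        if x = ?e then F ?e * L (a - e0, b - e1, c - e2) else 0)"
      unfolding pmul_def prod.case
    proof (rule sum.cong)
      fix x assume x: "x \<in> {0..a} \<times> {0..b} \<times> {0..c}"
      obtain i j k where ijk: "x = (i, j, k)" by (cases x)
      show "(case x of (i, j, k) \<Rightarrow> F (i, j, k) * L (a - i, b - j, c - k))
          = (if x = ?e then F ?e * L (a - e0, b - e1, c - e2) else 0)"
        using 0[of i j k] x ijk by (cases "x = ?e") auto
    qed simp
    then show ?thesis by (simp add: sum.delta)
  qed
  have le: "?w g \<le> \<mu>" if "L g \<noteq> 0" for g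
  proof -
    have fin: "finite (?w ` {g. L g \<noteq> 0})" using L by (simp add: is_poly_def)
    define \<nu> where "\<nu> = Max (?w ` {g. L g \<noteq> 0})"
    have \<nu>: "?w g \<le> \<nu>" if "L g \<noteq> 0" for g unfolding \<nu>_def using fin that by (intro Max_ge) auto
    have "\<nu> \<in> ?w ` {g. L g \<noteq> 0}" unfolding \<nu>_def using that by (intro Max_in[OF fin]) blast
    then obtain g' where g': "L g' \<noteq> 0" "?w g' = \<nu>" by blast
    obtain g0 g1 g2 where g: "g' = (g0, g1, g2)" by (cases g')
    have "?w (e0 + g0, e1 + g1, e2 + g2) = ?w ?e + \<nu>"
      unfolding g'(2)[symmetric] g by (simp add: weight_def distrib_left)
    moreover from this have "pmul F L (e0 + g0, e1 + g1, e2 + g2) = F ?e * L g'"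
      using key[of \<nu> "e0 + g0" "e1 + g1" "e2 + g2", OF _ \<nu>] g by simp
    then have "pmul F L (e0 + g0, e1 + g1, e2 + g2) \<noteq> 0" using g'(1) Fe by simp
    note supp[OF this]
    ultimately have "\<nu> \<le> \<mu>" by linarith
    then show ?thesis using \<nu>[OF that] by linarith
  qed
  then show "L g \<noteq> 0 \<Longrightarrow> ?w g \<le> \<mu>" .
  show "?w (a, b, c) = ?w ?e + \<mu> \<Longrightarrow> pmul F L (a, b, c)
      = (if e0 \<le> a \<and> e1 \<le> b \<and> e2 \<le> c then F ?e * L (a - e0, b - e1, c - e2) else 0)"
    using key[of \<mu> a b c, OF _ le] by simp
qed

section \<open>Reduction of polynomials modulo a place\<close>

definition reduces :: "(complex \<times> complex) set \<Rightarrow> cpoly \<Rightarrow> cpoly \<Rightarrow> bool" where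
  "reduces R F G \<longleftrightarrow> (\<forall>e. (F e, G e) \<in> R)"

context
  fixes R assumes h: "partial_hom R"
begin

lemma reduces_unique: "reduces R F G \<Longrightarrow> reduces R F G' \<Longrightarrow> G = G'"
  using partial_hom_unique[OF h] unfolding reduces_def by blast

lemma reduces_padd: "reduces R F F' \<Longrightarrow> reduces R G G' \<Longrightarrow> reduces R (padd F G) (padd F' G')"
  by (simp add: reduces_def padd_def partial_hom_add[OF h])

lemma reduces_psub: "reduces R F F' \<Longrightarrow> reduces R G G' \<Longrightarrow> reduces R (psub F G) (psub F' G')"
  by (simp add: reduces_def psub_def partial_hom_diff[OF h])

lemma reduces_pscale: "(a, b) \<in> R \<Longrightarrow> reduces R F F' \<Longrightarrow> reduces R (pscale a F) (pscale b F')"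
  by (simp add: reduces_def pscale_def partial_hom_mult[OF h])

lemma reduces_pmul: "reduces R F F' \<Longrightarrow> reduces R G G' \<Longrightarrow> reduces R (pmul F G) (pmul F' G')"
  by (auto simp: reduces_def pmul_def split: prod.split
      intro!: partial_hom_sum[OF h] partial_hom_mult[OF h])

lemma reduces_dx:
  assumes "reduces R F F'"
  shows "reduces R (dx0 F) (dx0 F')" "reduces R (dx1 F) (dx1 F')" "reduces R (dx2 F) (dx2 F')"
proof -
  have "(of_nat n * F e, of_nat n * F' e) \<in> R" for n e
    using assms unfolding reduces_def by (intro partial_hom_mult[OF h] partial_hom_of_nat[OF h]) blast
  then show "reduces R (dx0 F) (dx0 F')" "reduces R (dx1 F) (dx1 F')" "reduces R (dx2 F) (dx2 F')"
    unfolding reduces_def dx0_def dx1_def dx2_def split_beta by blast+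
qed

lemma reduces_zero: "reduces R (\<lambda>_. 0) (\<lambda>_. 0)"
  by (simp add: reduces_def partial_hom_zero[OF h])

lemma reduces_support: "reduces R F F' \<Longrightarrow> F' e \<noteq> 0 \<Longrightarrow> F e \<noteq> 0"
  using partial_hom_0D[OF h] unfolding reduces_def by metis

lemma is_poly_reduces: "reduces R F F' \<Longrightarrow> is_poly F \<Longrightarrow> is_poly F'"
  unfolding is_poly_def using reduces_support by (elim finite_subset[rotated]) auto

lemma quasi_hom_reduces: "reduces R F F' \<Longrightarrow> quasi_hom l0 l1 l2 n F \<Longrightarrow> quasi_hom l0 l1 l2 n F'"
  unfolding quasi_hom_def using reduces_support is_poly_reduces by blast

end

lemma quasi_hom_pscale: "quasi_hom l0 l1 l2 n F \<Longrightarrow> quasi_hom l0 l1 l2 n (pscale k F)"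
  by (auto simp: quasi_hom_def is_poly_pscale) (auto simp: pscale_def)

lemma ex_primitive_multiple:
  assumes R: "max_hom R" and T: "is_poly T" "T \<noteq> (\<lambda>_. 0)"
  shows "\<exists>\<mu> T'. \<mu> \<noteq> 0 \<and> reduces R (pscale (inverse \<mu>) T) T' \<and> T' \<noteq> (\<lambda>_. 0)"
proof -
  note h = max_hom_imp_partial_hom[OF R]
  obtain e where "T e \<noteq> 0" using T(2) by blast
  then have "\<exists>x\<in>T ` {e. T e \<noteq> 0}. x \<noteq> 0" by blast
  moreover have "finite (T ` {e. T e \<noteq> 0})" using T(1) by (simp add: is_poly_def)
  ultimately obtain \<mu> where \<mu>: "\<mu> \<in> T ` {e. T e \<noteq> 0}" "\<mu> \<noteq> 0"
    "\<forall>x\<in>T ` {e. T e \<noteq> 0}. \<exists>t. (x / \<mu>, t) \<in> R"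
    using max_hom_normalize[OF R, of "T ` {e. T e \<noteq> 0}"] by blast
  have "\<exists>t. (inverse \<mu> * T e, t) \<in> R" for e
  proof (cases "T e = 0")
    case True
    then show ?thesis using partial_hom_zero[OF h] by auto
  next
    case False
    then have "T e \<in> T ` {e. T e \<noteq> 0}" by blast
    then show ?thesis using \<mu>(3) by (metis divide_inverse mult.commute)
  qed
  then obtain T' where T': "\<And>e. (inverse \<mu> * T e, T' e) \<in> R" by metis
  obtain e' where "\<mu> = T e'" using \<mu>(1) by auto
  then have "(1, T' e') \<in> R" using T'[of e'] \<mu>(2) by simp
  then have "T' e' = 1" using partial_hom_unique[OF h] partial_hom_one[OF h] by blast
  then have "T' \<noteq> (\<lambda>_. 0)" by auto
  then show ?thesis using T' \<mu>(2) by (auto simp: reduces_def pscale_def)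
qed

text \<open>If the dominating coefficient \<mu> of \<open>T\<close> were infinite, \<open>F\<close>
  times \<open>T\<close> divided by \<mu> would reduce to 0, because \<open>H\<close> is multiplied
  by a number of value 0, and also to a product of two nonzero reductions.\<close>

lemma gauss_lemma:
  assumes R: "max_hom R" and F: "reduces R F F'" "F' \<noteq> (\<lambda>_. 0)"
    and T: "is_poly T" and H: "reduces R (pmul F T) H"
  shows "\<exists>T'. reduces R T T'"
proof (cases "T = (\<lambda>_. 0)")
  case True
  then show ?thesis using reduces_zero max_hom_imp_partial_hom[OF R] by blast
next
  case False
  note h = max_hom_imp_partial_hom[OF R]
  obtain \<mu> T' where \<mu>: "\<mu> \<noteq> 0" "reduces R (pscale (inverse \<mu>) T) T'" "T' \<noteq> (\<lambda>_. 0)"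
    using ex_primitive_multiple[OF R T False] by blast
  show ?thesis
  proof (cases "\<exists>t. (\<mu>, t) \<in> R")
    case True
    then obtain t where "(\<mu>, t) \<in> R" by blast
    from reduces_pscale[OF h this \<mu>(2)] show ?thesis
      using \<mu>(1) by (auto simp: pscale_def simp flip: mult.assoc)
  next
    case False
    then have "(inverse \<mu>, 0) \<in> R" using max_hom_valuation[OF R] by blast
    from reduces_pscale[OF h this H] have "reduces R (pmul F (pscale (inverse \<mu>) T)) (\<lambda>_. 0)"
      by (simp add: pmul_pscale_right pscale_def[of 0])
    moreover have "reduces R (pmul F (pscale (inverse \<mu>) T)) (pmul F' T')"
      by (rule reduces_pmul[OF h F(1) \<mu>(2)])
    ultimately have "pmul F' T' = (\<lambda>_. 0)" using reduces_unique[OF h] by blast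
    then show ?thesis using F(2) \<mu>(3) by (simp add: pmul_eq_0_iff)
  qed
qed

section \<open>A vector field whose only invariant curve is a coordinate line\<close>

lemma ex_leading_exponent:
  assumes F: "is_poly F" "F \<noteq> (\<lambda>_. 0)"
    and inj: "\<And>e f. F e \<noteq> 0 \<Longrightarrow> F f \<noteq> 0 \<Longrightarrow> w e = (w f :: int) \<Longrightarrow> e = f"
  obtains e0 e1 e2 where "F (e0, e1, e2) \<noteq> 0"
    "\<And>f. F f \<noteq> 0 \<Longrightarrow> w f \<le> w (e0, e1, e2)"
    "\<And>f. F f \<noteq> 0 \<Longrightarrow> f \<noteq> (e0, e1, e2) \<Longrightarrow> w f < w (e0, e1, e2)"
proof -
  have fin: "finite (w ` {e. F e \<noteq> 0})" using F(1) by (simp add: is_poly_def)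
  obtain x where "F x \<noteq> 0" using F(2) by blast
  then have "w ` {e. F e \<noteq> 0} \<noteq> {}" by blast
  from Max_in[OF fin this] obtain e where e: "F e \<noteq> 0" "w e = Max (w ` {e. F e \<noteq> 0})" by auto
  have le: "w f \<le> w e" if "F f \<noteq> 0" for f
    unfolding e(2) using fin that by (intro Max_ge) blast+
  have less: "w f < w e" if "F f \<noteq> 0" "f \<noteq> e" for f
    using le[OF that(1)] inj[OF that(1) e(1)] that(2) by fastforce
  show thesis using that[of "fst e" "fst (snd e)" "snd (snd e)"] e(1) le less by simp
qed

lemma ex_exponent_bound:
  assumes "is_poly F"
  obtains B where "\<And>i j k. F (i, j, k) \<noteq> 0 \<Longrightarrow> i \<le> B \<and> j \<le> B \<and> k \<le> B"
proof -
  define g where "g e = (case e of (i, j, k) \<Rightarrow> i + j + k)" for e :: "nat \<times> nat \<times> nat"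
  have fin: "finite (g ` {e. F e \<noteq> 0})" using assms by (simp add: is_poly_def)
  have "i + j + k \<le> Max (g ` {e. F e \<noteq> 0})" if "F (i, j, k) \<noteq> 0" for i j k
  proof (rule Max_ge[OF fin])
    show "i + j + k \<in> g ` {e. F e \<noteq> 0}"
      using that by (intro image_eqI[of _ _ "(i, j, k)"]) (auto simp: g_def)
  qed
  then have "i \<le> Max (g ` {e. F e \<noteq> 0}) \<and> j \<le> Max (g ` {e. F e \<noteq> 0}) \<and> k \<le> Max (g ` {e. F e \<noteq> 0})"
    if "F (i, j, k) \<noteq> 0" for i j k using that by fastforce
  then show thesis by (rule that)
qed

text \<open>Allows one integer weight to encode a lexicographic order on the exponents that
  occur.\<close>

lemma lex_le_iff:
  fixes N a a' b b' :: int
  assumes "0 \<le> b" "b < N" "0 \<le> b'" "b' < N"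
  shows "N * a + b \<le> N * a' + b' \<longleftrightarrow> a < a' \<or> a = a' \<and> b \<le> b'"
proof -
  have "N * a + N \<le> N * a'" if "a < a'"
    using mult_left_mono[of "a + 1" a' N] that assms by (simp add: algebra_simps)
  moreover have "N * a' + N \<le> N * a" if "a' < a"
    using mult_left_mono[of "a' + 1" a N] that assms by (simp add: algebra_simps)
  ultimately show ?thesis using assms by (cases a a' rule: linorder_cases) auto
qed

lemma lex_eq_iff:
  fixes N a a' b b' :: int
  assumes "0 \<le> b" "b < N" "0 \<le> b'" "b' < N"
  shows "N * a + b = N * a' + b' \<longleftrightarrow> a = a' \<and> b = b'"
  using lex_le_iff[OF assms, of a a'] lex_le_iff[OF assms(3,4,1,2), of a' a] by auto

text \<open>The equations say that all four monomial fields raise the weighted degree by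
  \<open>m\<close>. Positive \<open>s1\<close>, \<open>s2\<close> make two of them vanish along x0 =
  0; \<open>q < t1\<close> and \<open>t2 < p\<close> decide which summand dominates in the
  leading-term arguments; the last condition prevents the perturbation from being absorbed by the
  diagonal part.\<close>

locale special_field =
  fixes l0 l1 l2 m p q s1 t1 s2 t2 u v :: nat
  assumes l: "1 \<le> l0" "l0 \<le> l1" "l1 \<le> l2"
    and pq: "l1 * p + l2 * q = m"
    and st1: "1 \<le> s1" "q < t1" "l0 * s1 + l2 * t1 = m + l1"
    and st2: "1 \<le> s2" "t2 < p" "l0 * s2 + l1 * t2 = m + l2"
    and uv: "l1 * u + l2 * v = m + l0" "\<not> (p \<le> u \<and> q \<le> v)"
begin

text \<open>The eigenvalue on x1^j x2^k of the diagonal field that is multiplied by x1^p x2^q in the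
  derivation below.\<close>

definition alpha :: "nat \<Rightarrow> nat \<Rightarrow> nat" where
  "alpha j k = (t1 - q) * j + (p + 1) * k"

text \<open>The derivation
  \<open>x1^p x2^q ((t1 - q) x1 \<partial>1 + (p + 1) x2 \<partial>2) + x0^s1 x2^t1 \<partial>1 + x0^s2 x1^t2 \<partial>2\<close>.
  The weights \<open>t1 - q\<close>, \<open>p + 1\<close> of the diagonal part are chosen such that it annihilates
  \<open>x1^p x2^q / (x0^s1 x1^(-1) x2^t1)\<close>, the ratio of the first two summands as multiples of diagonal
  fields.\<close>

definition D0 :: "cpoly \<Rightarrow> cpoly" where
  "D0 F = (\<lambda>(i, j, k).
     (if p \<le> j \<and> q \<le> k then of_nat (alpha (j - p) (k - q)) * F (i, j - p, k - q) else 0) +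
     (if s1 \<le> i \<and> t1 \<le> k then of_nat (j + 1) * F (i - s1, j + 1, k - t1) else 0) +
     (if s2 \<le> i \<and> t2 \<le> j then of_nat (k + 1) * F (i - s2, j - t2, k + 1) else 0))"

text \<open>Subtracting the \<kappa>-term removes the monomials of eigenvalue \<kappa> from the
  diagonal part; \<kappa> = 0 gives the support of \<open>D0 F\<close> itself.\<close>

lemma D0_support:
  assumes "D0 F (i, j, k) - \<kappa> * (if p \<le> j \<and> q \<le> k then F (i, j - p, k - q) else 0) \<noteq> 0"
  obtains f1 f2 where "F (i, f1, f2) \<noteq> 0" "j = f1 + p" "k = f2 + q" "of_nat (alpha f1 f2) \<noteq> \<kappa>"
  | f0 f2 where "F (f0, j + 1, f2) \<noteq> 0" "i = f0 + s1" "k = f2 + t1"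
  | f0 f1 where "F (f0, f1, k + 1) \<noteq> 0" "i = f0 + s2" "j = f1 + t2"
proof -
  consider "p \<le> j \<and> q \<le> k \<and> (of_nat (alpha (j - p) (k - q)) - \<kappa>) * F (i, j - p, k - q) \<noteq> 0"
    | "s1 \<le> i \<and> t1 \<le> k \<and> F (i - s1, j + 1, k - t1) \<noteq> 0"
    | "s2 \<le> i \<and> t2 \<le> j \<and> F (i - s2, j - t2, k + 1) \<noteq> 0"
    using assms unfolding D0_def by (fastforce simp: left_diff_distrib split: if_splits)
  then show thesis
  proof cases
    case 1
    then show ?thesis using that(1)[of "j - p" "k - q"] by auto
  next
    case 2
    then show ?thesis using that(2)[of "i - s1" "k - t1"] by auto
  next
    case 3
    then show ?thesis using that(3)[of "i - s2" "j - t2"] by auto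
  qed
qed

context
  fixes n F L
  assumes F: "quasi_hom l0 l1 l2 (int n) F" "F \<noteq> (\<lambda>_. 0)"
    and L: "is_poly L" and eigen: "D0 F = pmul F L"
begin

lemma poly_F: "is_poly F"
  using F(1) by (simp add: quasi_hom_def)

text \<open>This is why the weights below can ignore x0 and still separate the monomials of
  \<open>F\<close>.\<close>

lemma F_unique: "F (i, j, k) \<noteq> 0 \<Longrightarrow> F (i', j, k) \<noteq> 0 \<Longrightarrow> i = i'"
proof -
  assume "F (i, j, k) \<noteq> 0" "F (i', j, k) \<noteq> 0"
  then have "l0 * i + l1 * j + l2 * k = n" "l0 * i' + l1 * j + l2 * k = n"
    using F(1) by (auto simp: quasi_hom_def wdeg_def simp del: of_nat_add of_nat_mult)
  then have "l0 * i = l0 * i'" by linarith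
  then show "i = i'" using l(1) by simp
qed

text \<open>In the order by x1-degree, then x2-degree, the diagonal part raises the weight most: the
  second summand lowers the x1-degree and the third raises it by \<open>t2 < p\<close>. Hence its
  eigenvalue at the leading monomial is a coefficient of the cofactor.\<close>

lemma cofactor_at_max_x1:
  obtains e0 e1 e2 where "F (e0, e1, e2) \<noteq> 0" "\<And>f0 f1 f2. F (f0, f1, f2) \<noteq> 0 \<Longrightarrow> f1 \<le> e1"
    "L (0, p, q) = of_nat (alpha e1 e2)"
proof -
  obtain B where B: "\<And>i j k. F (i, j, k) \<noteq> 0 \<Longrightarrow> i \<le> B \<and> j \<le> B \<and> k \<le> B"
    using ex_exponent_bound[OF poly_F] by blast
  define N where "N = int (B + t1 + 1)"
  have w: "weight 0 N 1 (i, j, k) = N * int j + int k" for i j k by (simp add: weight_def)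
  have N: "int k < N" if "F (i, j, k) \<noteq> 0" for i j k using B[OF that] by (simp add: N_def)
  obtain e0 e1 e2 where e: "F (e0, e1, e2) \<noteq> 0"
    and le: "\<And>f. F f \<noteq> 0 \<Longrightarrow> weight 0 N 1 f \<le> weight 0 N 1 (e0, e1, e2)"
    and less: "\<And>f. F f \<noteq> 0 \<Longrightarrow> f \<noteq> (e0, e1, e2) \<Longrightarrow> weight 0 N 1 f < weight 0 N 1 (e0, e1, e2)"
  proof (rule ex_leading_exponent[OF poly_F F(2), of "weight 0 N 1"])
    fix e f assume *: "F e \<noteq> 0" "F f \<noteq> 0" "weight 0 N 1 e = weight 0 N 1 f"
    obtain i j k i' j' k' where ef: "e = (i, j, k)" "f = (i', j', k')" by (metis prod_cases3)
    then show "e = f" using * N F_unique by (auto simp: w lex_eq_iff)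
  qed blast
  have max: "f1 \<le> e1" if "F (f0, f1, f2) \<noteq> 0" for f0 f1 f2
    using le[OF that] N[OF that] N[OF e] by (auto simp: w lex_le_iff)
  have Np: "N * int t2 + N \<le> N * int p"
    using mult_left_mono[of "int t2 + 1" "int p" N] st2(2) by (auto simp: N_def algebra_simps)
  have supp: "weight 0 N 1 h \<le> weight 0 N 1 (e0, e1, e2) + (N * int p + int q)"
    if h: "pmul F L h \<noteq> 0" for h
  proof -
    obtain i j k where h': "h = (i, j, k)" by (metis prod_cases3)
    then have "D0 F (i, j, k) - 0 * (if p \<le> j \<and> q \<le> k then F (i, j - p, k - q) else 0) \<noteq> 0"
      using h eigen by simp
    then show ?thesis
    proof (cases rule: D0_support)
      case (1 f1 f2)
      then show ?thesis using le[OF 1(1)] by (simp add: h' w algebra_simps)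
    next
      case (2 f0 f2)
      have "int t1 \<le> N" "0 \<le> N * int p" by (simp_all add: N_def)
      moreover have "weight 0 N 1 h = weight 0 N 1 (f0, j + 1, f2) - N + int t1"
        by (simp add: h' w 2 algebra_simps)
      ultimately show ?thesis using le[OF 2(1)] by linarith
    next
      case (3 f0 f1)
      have "0 \<le> N" by (simp add: N_def)
      moreover have "weight 0 N 1 h = weight 0 N 1 (f0, f1, k + 1) + N * int t2 - 1"
        by (simp add: h' w 3 algebra_simps)
      ultimately show ?thesis using le[OF 3(1)] Np by linarith
    qed
  qed
  have "pmul F L (e0, e1 + p, e2 + q) = F (e0, e1, e2) * L (0, p, q)"
    using pmul_leading_term(2)[where F = F, OF L e less supp, of e0 "e1 + p" "e2 + q"]
    by (simp add: w algebra_simps)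
  moreover have "D0 F (e0, e1 + p, e2 + q) = of_nat (alpha e1 e2) * F (e0, e1, e2)"
  proof -
    have "F (f0, f1, f2) = 0" if "f1 > e1" for f0 f1 f2 using max that by fastforce
    then show ?thesis using st2(2) by (simp add: D0_def)
  qed
  ultimately have "L (0, p, q) = of_nat (alpha e1 e2)" using e eigen by simp
  with e max show thesis by (rule that)
qed

text \<open>The order is by \<open>alpha\<close>, then by x1-degree. The first two summands raise
  \<open>alpha\<close> equally, so once the eigenvalue \<kappa> of the leading monomial is
  subtracted from the cofactor, the second summand dominates, and it must annihilate the leading
  monomial.\<close>

lemma cofactor_at_max_alpha:
  obtains e2 where "\<And>f0 f1 f2. F (f0, f1, f2) \<noteq> 0 \<Longrightarrow> alpha f1 f2 \<le> alpha 0 e2"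
    "\<And>f0 f1 f2. F (f0, f1, f2) \<noteq> 0 \<Longrightarrow> alpha f1 f2 = alpha 0 e2 \<Longrightarrow> f1 = 0"
    "L (0, p, q) = of_nat (alpha 0 e2)"
proof -
  obtain B where B: "\<And>i j k. F (i, j, k) \<noteq> 0 \<Longrightarrow> i \<le> B \<and> j \<le> B \<and> k \<le> B"
    using ex_exponent_bound[OF poly_F] by blast
  define N where "N = int (B + p + t2 + 2)"
  have N0: "0 \<le> N" by (simp add: N_def)
  define A1 A2 where "A1 = int (t1 - q)" and "A2 = int (p + 1)"
  define n1 n2 where "n1 = N * A1 + 1" and "n2 = N * A2"
  let ?w = "weight 0 n1 n2"
  have alpha: "int (alpha j k) = A1 * int j + A2 * int k" for j k
    unfolding alpha_def A1_def A2_def by (simp only: of_nat_add of_nat_mult)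
  have w: "?w (i, j, k) = N * int (alpha j k) + int j" for i j k
    by (simp add: n1_def n2_def weight_def alpha algebra_simps)
  define U where "U = A1 * int p + A2 * int q"
  \<comment> \<open>The shifts of \<open>alpha\<close> by the first two summands agree; this is the
    purpose of the weights \<open>t1 - q\<close> and \<open>p + 1\<close>.\<close>
  have U: "U = A2 * int t1 - A1"
    using st1(2) by (simp add: U_def A1_def A2_def of_nat_diff algebra_simps)
  have N: "int j + int p + 1 < N" "int j < N" if "F (i, j, k) \<noteq> 0" for i j k
    using B[OF that] by (auto simp: N_def)
  \<comment> \<open>The third summand raises the weight by less than \<open>N * U - 1\<close>, the
    shift of the second.\<close>
  have UN: "N * (A1 * int t2 - A2) + int t2 + 2 \<le> N * U"
  proof -
    have "A1 * int t2 \<le> A1 * int p" using st2(2) by (intro mult_left_mono) (auto simp: A1_def)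
    moreover have "0 \<le> A2 * int q" "1 \<le> A2" by (auto simp: A2_def)
    ultimately have "A1 * int t2 - A2 + 1 \<le> U" unfolding U_def by linarith
    then have "N * (A1 * int t2 - A2 + 1) \<le> N * U" by (rule mult_left_mono) fact
    moreover have "int t2 + 2 \<le> N" by (simp add: N_def)
    ultimately show ?thesis by (simp add: algebra_simps)
  qed
  obtain e0 e1 e2 where e: "F (e0, e1, e2) \<noteq> 0"
    and le: "\<And>f. F f \<noteq> 0 \<Longrightarrow> ?w f \<le> ?w (e0, e1, e2)"
    and less: "\<And>f. F f \<noteq> 0 \<Longrightarrow> f \<noteq> (e0, e1, e2) \<Longrightarrow> ?w f < ?w (e0, e1, e2)"
  proof (rule ex_leading_exponent[OF poly_F F(2), of ?w])
    fix e f assume *: "F e \<noteq> 0" "F f \<noteq> 0" "?w e = ?w f"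
    obtain i j k i' j' k' where ef: "e = (i, j, k)" "f = (i', j', k')" by (metis prod_cases3)
    then have "alpha j k = alpha j' k'" "j = j'"
      using * N(2)[of i j k] N(2)[of i' j' k'] by (auto simp: w lex_eq_iff)
    moreover from this have "k = k'" by (simp add: alpha_def del: mult_Suc)
    ultimately show "e = f" using * ef F_unique by auto
  qed blast
  define \<kappa> where "\<kappa> = alpha e1 e2"
  have max: "alpha f1 f2 \<le> \<kappa>" "alpha f1 f2 = \<kappa> \<Longrightarrow> f1 \<le> e1" if "F (f0, f1, f2) \<noteq> 0" for f0 f1 f2
    using le[OF that] N(2)[OF that] N(2)[OF e] unfolding \<kappa>_def by (auto simp: w lex_le_iff)
  define L' where "L' = psub L (pscale (of_nat \<kappa>) (monomial (0, p, q)))"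
  have L': "is_poly L'" unfolding L'_def by (intro is_poly_psub is_poly_pscale is_poly_monomial L)
  have FL': "pmul F L' (i, j, k)
      = D0 F (i, j, k) - of_nat \<kappa> * (if p \<le> j \<and> q \<le> k then F (i, j - p, k - q) else 0)" for i j k
    unfolding L'_def pmul_psub_right pmul_pscale_right eigen pmul_commute[of F "monomial _"]
    by (simp add: psub_def pscale_def pmul_monomial)
  have supp: "?w h \<le> ?w (e0, e1, e2) + (N * U - 1)" if h: "pmul F L' h \<noteq> 0" for h
  proof -
    obtain i j k where h': "h = (i, j, k)" by (metis prod_cases3)
    have "D0 F (i, j, k) - of_nat \<kappa> * (if p \<le> j \<and> q \<le> k then F (i, j - p, k - q) else 0) \<noteq> 0"
      using h h' FL' by simp
    then show ?thesis
    proof (cases rule: D0_support)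
      case (1 f1 f2)
      then have "alpha f1 f2 < \<kappa>" using max(1)[OF 1(1)] by (metis le_neq_implies_less)
      then have "N * (int (alpha f1 f2) + 1) \<le> N * int \<kappa>" using N0 by (intro mult_left_mono) auto
      moreover have "?w h = N * int (alpha f1 f2) + int f1 + N * U + int p"
        by (simp add: h' w 1 alpha U_def algebra_simps)
      ultimately show ?thesis using N(1)[OF 1(1)] by (simp add: w \<kappa>_def algebra_simps)
    next
      case (2 f0 f2)
      have "?w h = ?w (f0, j + 1, f2) + N * U - 1"
        by (simp add: h' w 2 alpha U algebra_simps)
      then show ?thesis using le[OF 2(1)] by simp
    next
      case (3 f0 f1)
      have "?w h = ?w (f0, f1, k + 1) + (N * (A1 * int t2 - A2) + int t2)"
        by (simp add: h' w 3 alpha algebra_simps)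
      then show ?thesis using le[OF 3(1)] UN by simp
    qed
  qed
  note lead = pmul_leading_term[where F = F, OF L' e less supp]
  have "e1 = 0"
  proof (rule ccontr)
    assume "e1 \<noteq> 0"
    then obtain e1' where e1: "e1 = Suc e1'" using not0_implies_Suc by blast
    \<comment> \<open>The exponent to which the second summand sends the leading monomial. Its
      x1-exponent is \<open>e1 - 1\<close>, so \<open>L'\<close> would need the x1-exponent -1 to
      contribute here.\<close>
    define h where "h = (e0 + s1, e1', e2 + t1)"
    have wh: "?w h = ?w (e0, e1, e2) + (N * U - 1)"
      using e1 by (simp add: h_def w alpha U of_nat_diff algebra_simps)
    then have "pmul F L' h = 0" using lead(2)[of "e0 + s1" e1' "e2 + t1"] e1 by (simp add: h_def)
    moreover have "pmul F L' h = of_nat e1 * F (e0, e1, e2)"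
    proof -
      \<comment> \<open>Whatever the diagonal part sends to \<open>h\<close> has eigenvalue \<kappa>
        too, and is removed by the subtraction.\<close>
      have a: "alpha (e1' - p) (e2 + t1 - q) = \<kappa>" if "p \<le> e1'"
      proof -
        have "int (alpha (e1' - p) (e2 + t1 - q)) = int \<kappa>"
          using that e1 st1(2) by (simp add: \<kappa>_def alpha A1_def A2_def of_nat_diff algebra_simps)
        then show ?thesis by simp
      qed
      have b: "F (f0, e1' - t2, e2 + t1 + 1) = 0" if "t2 \<le> e1'" for f0
      proof (rule ccontr)
        assume "F (f0, e1' - t2, e2 + t1 + 1) \<noteq> 0"
        from le[OF this] have "?w (f0, e1' - t2, e2 + t1 + 1) \<le> ?w (e0, e1, e2)" .
        moreover have "?w h = ?w (f0, e1' - t2, e2 + t1 + 1) + (N * (A1 * int t2 - A2) + int t2)"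
          using that by (simp add: h_def w alpha of_nat_diff algebra_simps)
        ultimately show False using UN wh by linarith
      qed
      have T1: "(if p \<le> e1' \<and> q \<le> e2 + t1
          then of_nat (alpha (e1' - p) (e2 + t1 - q)) * F (e0 + s1, e1' - p, e2 + t1 - q) else 0)
        = of_nat \<kappa> * (if p \<le> e1' \<and> q \<le> e2 + t1 then F (e0 + s1, e1' - p, e2 + t1 - q) else 0)"
        using a by (cases "p \<le> e1' \<and> q \<le> e2 + t1") (simp_all only: if_P if_not_P if_False mult_zero_right)
      have T3: "(if s2 \<le> e0 + s1 \<and> t2 \<le> e1'
          then of_nat (e2 + t1 + 1) * F (e0 + s1 - s2, e1' - t2, e2 + t1 + 1) else 0) = 0"
        using b by (cases "s2 \<le> e0 + s1 \<and> t2 \<le> e1'") (simp_all only: if_P if_not_P if_False mult_zero_right)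
      show ?thesis
        unfolding h_def FL' D0_def prod.case T1 T3 e1 by simp
    qed
    ultimately show False using e e1 by (simp del: of_nat_Suc)
  qed
  \<comment> \<open>The exponent \<open>(0, p, q)\<close> has weight \<open>N * U + p\<close>, above
    the bound \<open>N * U - 1\<close> for \<open>L'\<close>.\<close>
  have "L' (0, p, q) = 0"
  proof (rule ccontr)
    assume "L' (0, p, q) \<noteq> 0"
    then show False using lead(1)[of "(0, p, q)"] by (simp add: w alpha U_def algebra_simps)
  qed
  then have "L (0, p, q) = of_nat \<kappa>" by (simp add: L'_def psub_def pscale_def monomial_def)
  then show thesis using that[of e2] max unfolding \<kappa>_def \<open>e1 = 0\<close> by simp
qed

text \<open>The same cofactor coefficient has been computed twice: a monomial of largest x1-degree
  attains the maximum of \<open>alpha\<close>, and monomials attaining it are free of x1.\<close>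

lemma no_x1: "F (f0, f1, f2) \<noteq> 0 \<Longrightarrow> f1 = 0"
proof -
  assume f: "F (f0, f1, f2) \<noteq> 0"
  obtain e0 e1 e2 where e: "F (e0, e1, e2) \<noteq> 0"
    "\<And>f0 f1 f2. F (f0, f1, f2) \<noteq> 0 \<Longrightarrow> f1 \<le> e1" "L (0, p, q) = of_nat (alpha e1 e2)"
    by (rule cofactor_at_max_x1) (rule that; blast)
  obtain e2' where "\<And>f0 f1 f2. F (f0, f1, f2) \<noteq> 0 \<Longrightarrow> alpha f1 f2 \<le> alpha 0 e2'"
    and e2': "\<And>f0 f1 f2. F (f0, f1, f2) \<noteq> 0 \<Longrightarrow> alpha f1 f2 = alpha 0 e2' \<Longrightarrow> f1 = 0"
    "L (0, p, q) = of_nat (alpha 0 e2')"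
    by (rule cofactor_at_max_alpha) (rule that; blast)
  have "alpha e1 e2 = alpha 0 e2'" using e(3) e2'(2) by simp
  then have "e1 = 0" using e2'(1) e(1) by blast
  then show "f1 = 0" using e(2)[OF f] by simp
qed

text \<open>Without x1 in \<open>F\<close> the second summand contributes nothing, and a large
  negative weight of x1 makes the third dominate the diagonal part, since \<open>t2 < p\<close>. At
  a leading monomial containing x2 it would require a cofactor term with x2-exponent -1.\<close>

lemma no_x2: "F (f0, f1, f2) \<noteq> 0 \<Longrightarrow> f2 = 0"
proof -
  assume f: "F (f0, f1, f2) \<noteq> 0"
  define N where "N = int q + 1"
  define n1 where "n1 = - N"
  let ?w = "weight 0 n1 1"
  have w: "?w (i, j, k) = int k - N * int j" for i j k by (simp add: n1_def weight_def)
  obtain e0 e1 e2 where e: "F (e0, e1, e2) \<noteq> 0"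
    and le: "\<And>f. F f \<noteq> 0 \<Longrightarrow> ?w f \<le> ?w (e0, e1, e2)"
    and less: "\<And>f. F f \<noteq> 0 \<Longrightarrow> f \<noteq> (e0, e1, e2) \<Longrightarrow> ?w f < ?w (e0, e1, e2)"
  proof (rule ex_leading_exponent[OF poly_F F(2), of ?w])
    fix e f assume *: "F e \<noteq> 0" "F f \<noteq> 0" "?w e = ?w f"
    obtain i j k i' j' k' where ef: "e = (i, j, k)" "f = (i', j', k')" by (metis prod_cases3)
    then have "j = 0" "j' = 0" using * no_x1 by blast+
    then show "e = f" using * ef F_unique by (auto simp: w)
  qed blast
  have e1: "e1 = 0" using no_x1 e by blast
  have Np: "N * int t2 + N \<le> N * int p"
    using mult_left_mono[of "int t2 + 1" "int p" N] st2(2) by (auto simp: N_def algebra_simps)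
  have supp: "?w h \<le> ?w (e0, e1, e2) + (- N * int t2 - 1)" if h: "pmul F L h \<noteq> 0" for h
  proof -
    obtain i j k where h': "h = (i, j, k)" by (metis prod_cases3)
    have "D0 F (i, j, k) - 0 * (if p \<le> j \<and> q \<le> k then F (i, j - p, k - q) else 0) \<noteq> 0"
      using h h' eigen by simp
    then show ?thesis
    proof (cases rule: D0_support)
      case (1 f1 f2)
      have "?w h = ?w (i, f1, f2) - N * int p + int q" by (simp add: h' w 1 algebra_simps)
      moreover have "int q + 1 \<le> N" by (simp add: N_def)
      ultimately show ?thesis using le[OF 1(1)] Np by simp
    next
      case (2 f0 f2)
      then show ?thesis using no_x1 by fastforce
    next
      case (3 f0 f1)
      then show ?thesis using le[OF 3(1)] by (simp add: h' w algebra_simps)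
    qed
  qed
  note lead = pmul_leading_term(2)[where F = F, OF L e less supp]
  have "e2 = 0"
  proof (rule ccontr)
    assume e2: "e2 \<noteq> 0"
    have "D0 F (e0 + s2, t2, e2 - 1) = 0"
      using lead[of "e0 + s2" t2 "e2 - 1"] e2 e1 by (simp add: w eigen of_nat_diff)
    moreover have "F (i, t2 + 1, k) = 0" for i k using no_x1 by fastforce
    ultimately have "of_nat e2 * F (e0, 0, e2) = 0" using st2(2) e2 by (simp add: D0_def split: if_splits)
    then show False using e e1 e2 by simp
  qed
  moreover have "f1 = 0" using no_x1 f by blast
  ultimately show "f2 = 0" using le[OF f] e1 by (simp add: w)
qed

end

text \<open>On the terms of lowest x0-degree only the diagonal part acts, as \<open>s1\<close> and
  \<open>s2\<close> are positive, and the inhomogeneous monomial is not divisible by x1^p x2^q. So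
  these terms have eigenvalue 0, hence are a multiple of x0^K, which is excluded.\<close>

lemma D0_first_order:
  assumes G: "quasi_hom l0 l1 l2 (int (l0 * K)) G" "G (K, 0, 0) = 0" and K: "0 < K"
    and eq: "\<And>i j k. i < K \<Longrightarrow> c * (if (i, j, k) = (K - 1, u, v) then 1 else 0) + D0 G (i, j, k) = 0"
  shows "G = (\<lambda>_. 0) \<and> c = 0"
proof -
  have deg: "l0 * i + l1 * j + l2 * k = l0 * K" if "G (i, j, k) \<noteq> 0" for i j k
    using G(1) that by (auto simp: quasi_hom_def wdeg_def simp del: of_nat_add of_nat_mult)
  have "G = (\<lambda>_. 0)"
  proof (rule ccontr)
    assume "G \<noteq> (\<lambda>_. 0)"
    then obtain x where "G x \<noteq> 0" by blast
    then have ex: "\<exists>i j k. G (i, j, k) \<noteq> 0" by (metis prod_cases3)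
    define i where "i = (LEAST i. \<exists>j k. G (i, j, k) \<noteq> 0)"
    obtain j k where jk: "G (i, j, k) \<noteq> 0" using LeastI_ex[OF ex] unfolding i_def by blast
    have min: "G (i', j', k') = 0" if "i' < i" for i' j' k'
      using not_less_Least[of i' "\<lambda>i. \<exists>j k. G (i, j, k) \<noteq> 0"] that unfolding i_def by blast
    have d: "l0 * i + l1 * j + l2 * k = l0 * K" using deg[OF jk] .
    have "i < K"
    proof (rule ccontr)
      assume "\<not> i < K"
      then have "l0 * K \<le> l0 * i" by simp
      then have "l1 * j + l2 * k = 0" "l0 * i = l0 * K" using d by linarith+
      then have "j = 0" "k = 0" "i = K" using l by auto
      then show False using jk G(2) by simp
    qed
    have "D0 G (i, j + p, k + q) = of_nat (alpha j k) * G (i, j, k)"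
      using min st1(1) st2(1) by (simp add: D0_def)
    moreover have "(i, j + p, k + q) \<noteq> (K - 1, u, v)" using uv(2) by auto
    then have "c * (if (i, j + p, k + q) = (K - 1, u, v) then 1 else 0) = 0"
      by (simp only: if_False mult_zero_right)
    ultimately have "of_nat (alpha j k) * G (i, j, k) = 0"
      using eq[OF \<open>i < K\<close>, of "j + p" "k + q"] by (simp only: add_0_left)
    then have "alpha j k = 0" using jk by (simp del: of_nat_add)
    then have "j = 0" "k = 0" using st1(2) by (auto simp: alpha_def)
    then show False using d \<open>i < K\<close> l(1) by simp
  qed
  moreover from this have "c = 0" using eq[of "K - 1" u v] K by (simp add: D0_def split: if_splits)
  ultimately show ?thesis ..
qed

end

section \<open>Vector fields and one-forms\<close>

text \<open>Up to sign, the contraction of the volume form with the Euler field and with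
  \<open>X0 \<partial>0 + X1 \<partial>1 + X2 \<partial>2\<close>.\<close>

definition rform :: "nat \<Rightarrow> nat \<Rightarrow> nat \<Rightarrow> cpoly \<Rightarrow> cpoly \<Rightarrow> cpoly \<Rightarrow> form1" where
  "rform l0 l1 l2 X0 X1 X2 =
     (psub (pscale (of_nat l2) (mulx2 X1)) (pscale (of_nat l1) (mulx1 X2)),
      psub (pscale (of_nat l0) (mulx0 X2)) (pscale (of_nat l2) (mulx2 X0)),
      psub (pscale (of_nat l1) (mulx1 X0)) (pscale (of_nat l0) (mulx0 X1)))"

definition deriv3 :: "cpoly \<Rightarrow> cpoly \<Rightarrow> cpoly \<Rightarrow> cpoly \<Rightarrow> cpoly" where
  "deriv3 X0 X1 X2 F = padd (pmul X0 (dx0 F)) (padd (pmul X1 (dx1 F)) (pmul X2 (dx2 F)))"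

lemma comp_rform:
  "comp 0 (rform l0 l1 l2 X0 X1 X2) = psub (pscale (of_nat l2) (mulx2 X1)) (pscale (of_nat l1) (mulx1 X2))"
  "comp (Suc 0) (rform l0 l1 l2 X0 X1 X2) = psub (pscale (of_nat l0) (mulx0 X2)) (pscale (of_nat l2) (mulx2 X0))"
  "comp 2 (rform l0 l1 l2 X0 X1 X2) = psub (pscale (of_nat l1) (mulx1 X0)) (pscale (of_nat l0) (mulx0 X1))"
  by (simp_all add: comp_def rform_def)

lemma contrR_rform: "contrR l0 l1 l2 (rform l0 l1 l2 X0 X1 X2) = (\<lambda>_. 0)"
  unfolding fps3_inject[symmetric]
  by (simp add: contrR_def comp_rform fps3_simps algebra_simps)

lemma euler_identity:
  assumes "quasi_hom l0 l1 l2 (int n) F"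
  shows "padd (pscale (of_nat l0) (mulx0 (dx0 F)))
      (padd (pscale (of_nat l1) (mulx1 (dx1 F))) (pscale (of_nat l2) (mulx2 (dx2 F)))) = pscale (of_nat n) F"
proof
  fix e :: "nat \<times> nat \<times> nat"
  obtain a b c where e: "e = (a, b, c)" by (metis prod_cases3)
  have "mulx0 (dx0 F) e = of_nat a * F e" "mulx1 (dx1 F) e = of_nat b * F e" "mulx2 (dx2 F) e = of_nat c * F e"
    by (auto simp: e mulx0_def mulx1_def mulx2_def dx0_def dx1_def dx2_def simp del: of_nat_Suc of_nat_add)
  moreover have "of_nat (l0 * a + l1 * b + l2 * c) * F e = of_nat n * F e"
    using assms unfolding quasi_hom_def wdeg_def e by (cases "F (a, b, c) = 0") auto
  ultimately show "padd (pscale (of_nat l0) (mulx0 (dx0 F)))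
      (padd (pscale (of_nat l1) (mulx1 (dx1 F))) (pscale (of_nat l2) (mulx2 (dx2 F)))) e = pscale (of_nat n) F e"
    by (simp add: padd_def pscale_def algebra_simps)
qed

text \<open>By Euler's identity, two components of the invariance equation become
  \<open>l0 x0 X(F) = F U0\<close> and \<open>l1 x1 X(F) = F U1\<close>. Eliminating
  \<open>X(F)\<close> and cancelling \<open>F\<close> shows that x0 divides \<open>U0\<close>; the
  cofactor is the quotient by \<open>l0 x0\<close>.\<close>

lemma ex_cofactor:
  assumes l: "0 < l0" "0 < l1" and X: "is_poly X0"
    and F: "quasi_hom l0 l1 l2 (int n) F" "F \<noteq> (\<lambda>_. 0)"
    and inv: "invariant_curve (rform l0 l1 l2 X0 X1 X2) F"
  shows "\<exists>L. is_poly L \<and> deriv3 X0 X1 X2 F = pmul F L"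
proof -
  obtain T02 T12 where T: "is_poly T02" "is_poly T12"
    and eq: "psub (pmul (comp 0 (rform l0 l1 l2 X0 X1 X2)) (dx2 F))
        (pmul (comp 2 (rform l0 l1 l2 X0 X1 X2)) (dx0 F)) = pmul F T02"
      "psub (pmul (comp (Suc 0) (rform l0 l1 l2 X0 X1 X2)) (dx2 F))
        (pmul (comp 2 (rform l0 l1 l2 X0 X1 X2)) (dx1 F)) = pmul F T12"
    using inv by (auto simp: invariant_curve_def)
  define U0 where "U0 = padd T12 (pscale (of_nat n) X0)"
  define U1 where "U1 = psub (pscale (of_nat n) X1) T02"
  note eqs = eq[unfolded comp_rform, unfolded fps3_inject[symmetric] fps3_simps]
  note eul = euler_identity[OF F(1), unfolded fps3_inject[symmetric] fps3_simps]
  define M where "M = deriv3 X0 X1 X2 F"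
  have M: "fps3 M = fps3 X0 * fps3 (dx0 F) + (fps3 X1 * fps3 (dx1 F) + fps3 X2 * fps3 (dx2 F))"
    by (simp add: M_def deriv3_def fps3_simps)
  have 0: "fps3_const (of_nat l0) * (fps_X * fps3 M) = fps3 F * fps3 U0"
    unfolding U0_def fps3_simps M using eqs(2) eul by algebra
  have 1: "fps3_const (of_nat l1) * (fps_const fps_X * fps3 M) = fps3 F * fps3 U1"
    unfolding U1_def fps3_simps M using eqs(1) eul by algebra
  have F0: "fps3 F \<noteq> 0" using F(2) by (simp add: fps3_zero[symmetric] fps3_inject del: fps3_zero)
  have "fps3 F * (fps3_const (of_nat l1) * (fps_const fps_X * fps3 U0)
      - fps3_const (of_nat l0) * (fps_X * fps3 U1)) = 0"
    using 0 1 by algebra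
  then have "pscale (of_nat l1) (mulx1 U0) = pscale (of_nat l0) (mulx0 U1)"
    using F0 by (simp add: fps3_simps flip: fps3_inject)
  then have "pscale (of_nat l1) (mulx1 U0) (0, Suc b, c) = pscale (of_nat l0) (mulx0 U1) (0, Suc b, c)" for b c
    by simp
  then have U00: "U0 (0, b, c) = 0" for b c
    using l(2) by (simp add: pscale_def mulx1_def mulx0_def)
  define L where "L = (\<lambda>(a, b, c). U0 (Suc a, b, c) / of_nat l0)"
  have "pscale (of_nat l0) (mulx0 L) = U0"
    using l(1) U00 by (auto simp: L_def pscale_def mulx0_def)
  then have "fps3_const (of_nat l0) * (fps_X * fps3 M) = fps3 F * (fps3_const (of_nat l0) * (fps_X * fps3 L))"
    using 0 by (metis fps3_mulx0 fps3_pscale)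
  then have "fps3_const (of_nat l0) * fps_X * (fps3 M - fps3 F * fps3 L) = 0" by algebra
  moreover have "fps3_const (of_nat l0) \<noteq> 0" using l(1) by simp
  ultimately have "fps3 M = fps3 F * fps3 L" by simp
  then have "M = pmul F L" by (simp add: fps3_simps flip: fps3_inject)
  moreover have "is_poly L"
  proof -
    have U0: "is_poly U0" unfolding U0_def by (intro is_poly_padd is_poly_pscale T X)
    have "{e. L e \<noteq> 0} \<subseteq> (\<lambda>(a, b, c). (a - 1, b, c)) ` {e. U0 e \<noteq> 0}"
    proof
      fix e assume "e \<in> {e. L e \<noteq> 0}"
      moreover obtain a b c where "e = (a, b, c)" by (metis prod_cases3)
      ultimately show "e \<in> (\<lambda>(a, b, c). (a - 1, b, c)) ` {e. U0 e \<noteq> 0}"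
        by (intro image_eqI[of _ _ "(Suc a, b, c)"]) (auto simp: L_def)
    qed
    then show ?thesis using U0 unfolding is_poly_def by (rule finite_subset[OF _ finite_imageI])
  qed
  ultimately show ?thesis unfolding M_def by blast
qed

lemma quasi_hom_padd: "quasi_hom l0 l1 l2 n F \<Longrightarrow> quasi_hom l0 l1 l2 n G \<Longrightarrow> quasi_hom l0 l1 l2 n (padd F G)"
  unfolding quasi_hom_def by (auto simp: is_poly_padd) (auto simp: padd_def, metis add.right_neutral)

lemma quasi_hom_psub: "quasi_hom l0 l1 l2 n F \<Longrightarrow> quasi_hom l0 l1 l2 n G \<Longrightarrow> quasi_hom l0 l1 l2 n (psub F G)"
  unfolding quasi_hom_def by (auto simp: is_poly_psub) (auto simp: psub_def, metis diff_zero)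

lemma quasi_hom_monomial:
  "l0 * a + l1 * b + l2 * c + k = d \<Longrightarrow> quasi_hom l0 l1 l2 (int d - int k) (monomial (a, b, c))"
  unfolding quasi_hom_def wdeg_def by (auto simp: is_poly_monomial) (auto simp: monomial_def split: if_splits)

lemma deriv3_pscale: "deriv3 X0 X1 X2 (pscale k F) = pscale k (deriv3 X0 X1 X2 F)"
proof -
  have "dx0 (pscale k F) = pscale k (dx0 F)" "dx1 (pscale k F) = pscale k (dx1 F)"
    "dx2 (pscale k F) = pscale k (dx2 F)"
    by (auto simp: dx0_def dx1_def dx2_def pscale_def)
  then show ?thesis by (simp add: deriv3_def fps3_simps algebra_simps flip: fps3_inject)
qed

lemma mulx_linear:
  "mulx0 (padd F G) = padd (mulx0 F) (mulx0 G)" "mulx0 (pscale k F) = pscale k (mulx0 F)"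
  "mulx1 (padd F G) = padd (mulx1 F) (mulx1 G)" "mulx1 (pscale k F) = pscale k (mulx1 F)"
  "mulx2 (padd F G) = padd (mulx2 F) (mulx2 G)" "mulx2 (pscale k F) = pscale k (mulx2 F)"
  by (simp_all add: fps3_simps algebra_simps flip: fps3_inject)

lemma mulx_monomial:
  "mulx0 (monomial (a, b, c)) = monomial (Suc a, b, c)"
  "mulx1 (monomial (a, b, c)) = monomial (a, Suc b, c)"
  "mulx2 (monomial (a, b, c)) = monomial (a, b, Suc c)"
  by (auto simp: mulx0_def mulx1_def mulx2_def monomial_def fun_eq_iff)

section \<open>A transcendental parameter and its specialization to 0\<close>

lemma ex_transcendental: "\<exists>x :: complex. \<not> algebraic x"
proof -
  have "{x :: complex. algebraic x} \<subseteq> (\<Union>xs. {x. poly (map_poly of_int (Poly xs)) x = 0 \<and> Poly xs \<noteq> 0})"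
  proof
    fix x :: complex assume "x \<in> {x. algebraic x}"
    then obtain p where "p \<noteq> 0" "poly (map_poly of_int p) x = 0" using algebraicE' by blast
    then show "x \<in> (\<Union>xs. {x. poly (map_poly of_int (Poly xs)) x = 0 \<and> Poly xs \<noteq> 0})"
      by (intro UN_I[of "coeffs p"]) auto
  qed
  moreover have "countable (\<Union>xs :: int list. {x :: complex. poly (map_poly of_int (Poly xs)) x = 0 \<and> Poly xs \<noteq> 0})"
  proof (intro countable_UN countableI_type)
    fix xs :: "int list"
    show "countable {x :: complex. poly (map_poly of_int (Poly xs)) x = 0 \<and> Poly xs \<noteq> 0}"
    proof (cases "Poly xs = 0")
      case False
      then have "map_poly of_int (Poly xs) \<noteq> (0 :: complex poly)" by (simp add: map_poly_eq_0_iff)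
      then show ?thesis using poly_roots_finite False by (auto intro: countable_finite)
    qed simp
  qed
  ultimately have "countable {x :: complex. algebraic x}" using countable_subset by blast
  then have "{x :: complex. algebraic x} \<noteq> UNIV" using uncountable_UNIV_complex by metis
  then show ?thesis by blast
qed

lemma partial_hom_transcendental:
  assumes "\<not> algebraic \<epsilon>"
  shows "partial_hom {(poly P \<epsilon>, poly P 0) | P. \<forall>i. coeff P i \<in> \<int>}" (is "partial_hom ?R")
  unfolding partial_hom_def
proof (intro conjI allI impI)
  show "(1, 1) \<in> ?R" by (force intro!: exI[of _ 1])
  fix a b c d assume "(a, b) \<in> ?R" "(c, d) \<in> ?R"
  then obtain P Q where PQ: "a = poly P \<epsilon>" "b = poly P 0" "\<forall>i. coeff P i \<in> \<int>"
    "c = poly Q \<epsilon>" "d = poly Q 0" "\<forall>i. coeff Q i \<in> \<int>" by blast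
  then have "\<forall>i. coeff (P * Q) i \<in> \<int>" "\<forall>i. coeff (P - Q) i \<in> \<int>"
    by (auto simp: coeff_mult intro!: Ints_sum)
  moreover have "a * c = poly (P * Q) \<epsilon>" "b * d = poly (P * Q) 0"
    "a - c = poly (P - Q) \<epsilon>" "b - d = poly (P - Q) 0" using PQ by simp_all
  ultimately show "(a - c, b - d) \<in> ?R" "(a * c, b * d) \<in> ?R" by blast+
next
  fix b assume "(0, b) \<in> ?R"
  then obtain P where P: "0 = poly P \<epsilon>" "b = poly P 0" "\<forall>i. coeff P i \<in> \<int>" by blast
  then have "P = 0" using assms unfolding algebraic_def by metis
  then show "b = 0" using P(2) by simp
qed

section \<open>The perturbed field and its one-form\<close>

context special_field
begin

definition Y1 :: cpoly where
  "Y1 = padd (pscale (of_nat (t1 - q)) (monomial (0, Suc p, q))) (monomial (s1, 0, t1))"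

definition Y2 :: cpoly where
  "Y2 = padd (pscale (of_nat (Suc p)) (monomial (0, p, Suc q))) (monomial (s2, t2, 0))"

abbreviation Y0 :: "complex \<Rightarrow> cpoly" where
  "Y0 \<epsilon> \<equiv> pscale \<epsilon> (monomial (0, u, v))"

lemma deriv3_Y:
  "deriv3 (Y0 \<epsilon>) Y1 Y2 F (i, j, k) = D0 F (i, j, k) + \<epsilon> * (if u \<le> j \<and> v \<le> k then of_nat (i + 1) * F (i + 1, j - u, k - v) else 0)"
proof -
  have 1: "of_nat (t1 - q) * (if Suc p \<le> j \<and> q \<le> k then of_nat (j - Suc p + 1) * F (i, j - Suc p + 1, k - q) else 0)
      = (if p \<le> j \<and> q \<le> k then of_nat ((t1 - q) * (j - p)) * F (i, j - p, k - q) else 0)"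
  proof (cases "p < j")
    case True
    then obtain r where "j = Suc (p + r)" using less_imp_Suc_add by blast
    then show ?thesis by (simp add: distrib_left distrib_right)
  qed auto
  have 2: "of_nat (Suc p) * (if p \<le> j \<and> Suc q \<le> k then of_nat (k - Suc q + 1) * F (i, j - p, k - Suc q + 1) else 0)
      = (if p \<le> j \<and> q \<le> k then of_nat (Suc p * (k - q)) * F (i, j - p, k - q) else 0)"
  proof (cases "q < k")
    case True
    then obtain r where "k = Suc (q + r)" using less_imp_Suc_add by blast
    then show ?thesis by (simp add: distrib_left distrib_right)
  qed auto
  have "deriv3 (Y0 \<epsilon>) Y1 Y2 F (i, j, k)
      = \<epsilon> * (if u \<le> j \<and> v \<le> k then of_nat (i + 1) * F (i + 1, j - u, k - v) else 0)
      + ((if p \<le> j \<and> q \<le> k then of_nat ((t1 - q) * (j - p)) * F (i, j - p, k - q) else 0)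
        + (if s1 \<le> i \<and> t1 \<le> k then of_nat (j + 1) * F (i - s1, j + 1, k - t1) else 0))
      + ((if p \<le> j \<and> q \<le> k then of_nat (Suc p * (k - q)) * F (i, j - p, k - q) else 0)
        + (if s2 \<le> i \<and> t2 \<le> j then of_nat (k + 1) * F (i - s2, j - t2, k + 1) else 0))"
    unfolding deriv3_def Y1_def Y2_def pmul_padd_left pmul_pscale_left
    unfolding padd_def pscale_def pmul_monomial dx0_def dx1_def dx2_def prod.case
    by (simp only: le0 simp_thms diff_zero mult_1_left 1 2 add.assoc)
  moreover have "(if p \<le> j \<and> q \<le> k then of_nat (alpha (j - p) (k - q)) * F (i, j - p, k - q) else 0)
      = (if p \<le> j \<and> q \<le> k then of_nat ((t1 - q) * (j - p)) * F (i, j - p, k - q) else 0)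
      + (if p \<le> j \<and> q \<le> k then of_nat (Suc p * (k - q)) * F (i, j - p, k - q) else 0)"
    by (simp add: alpha_def distrib_right del: of_nat_mult mult_Suc)
  ultimately show ?thesis unfolding D0_def prod.case by (simp only: add_ac)
qed

lemma reduces_deriv3_Y:
  assumes h: "partial_hom R" and "reduces R F F'" "(\<epsilon>, \<epsilon>') \<in> R"
  shows "reduces R (deriv3 (Y0 \<epsilon>) Y1 Y2 F) (deriv3 (Y0 \<epsilon>') Y1 Y2 F')"
proof -
  have "reduces R (monomial e) (monomial e)" for e
    using partial_hom_zero[OF h] partial_hom_one[OF h] by (auto simp: reduces_def monomial_def)
  then show ?thesis
    unfolding deriv3_def Y1_def Y2_def using assms
    by (intro reduces_padd[OF h] reduces_pmul[OF h] reduces_pscale[OF h] reduces_dx[OF h]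
        partial_hom_of_nat[OF h]) auto
qed

lemma rform_in_FolSpace: "rform l0 l1 l2 (Y0 \<epsilon>) Y1 Y2 \<in> FolSpace l0 l1 l2 (int (m + l0 + l1 + l2))"
  unfolding FolSpace_def mem_Collect_eq
proof (intro conjI contrR_rform)
  note e = pq st1(3) st2(3) uv(1)
  show "quasi_hom l0 l1 l2 (int (m + l0 + l1 + l2) - int l0) (comp 0 (rform l0 l1 l2 (Y0 \<epsilon>) Y1 Y2))"
    unfolding comp_rform Y1_def Y2_def mulx_linear mulx_monomial
    by (intro quasi_hom_psub quasi_hom_padd quasi_hom_pscale quasi_hom_monomial)
      (simp_all only: mult_0_right mult_Suc_right add_0_left add_0_right, (use e in linarith)+)
  show "quasi_hom l0 l1 l2 (int (m + l0 + l1 + l2) - int l1) (comp 1 (rform l0 l1 l2 (Y0 \<epsilon>) Y1 Y2))"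
    unfolding One_nat_def comp_rform Y1_def Y2_def mulx_linear mulx_monomial
    by (intro quasi_hom_psub quasi_hom_padd quasi_hom_pscale quasi_hom_monomial)
      (simp_all only: mult_0_right mult_Suc_right add_0_left add_0_right, (use e in linarith)+)
  show "quasi_hom l0 l1 l2 (int (m + l0 + l1 + l2) - int l2) (comp 2 (rform l0 l1 l2 (Y0 \<epsilon>) Y1 Y2))"
    unfolding comp_rform Y1_def Y2_def mulx_linear mulx_monomial
    by (intro quasi_hom_psub quasi_hom_padd quasi_hom_pscale quasi_hom_monomial)
      (simp_all only: mult_0_right mult_Suc_right add_0_left add_0_right, (use e in linarith)+)
qed

theorem ex_no_invariant_curve:
  "\<exists>\<omega>\<in>FolSpace l0 l1 l2 (int (m + l0 + l1 + l2)). \<not> admits_invariant_curve l0 l1 l2 \<omega>"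
proof -
  obtain \<epsilon> :: complex where \<epsilon>: "\<not> algebraic \<epsilon>" using ex_transcendental by blast
  define R0 where "R0 = {(poly P \<epsilon>, poly P 0) | P. \<forall>i. coeff P i \<in> \<int>}"
  have "partial_hom R0" unfolding R0_def by (rule partial_hom_transcendental[OF \<epsilon>])
  then obtain R where R0: "R0 \<subseteq> R" and R: "max_hom R" using ex_max_hom by blast
  note h = max_hom_imp_partial_hom[OF R]
  have "\<forall>i. coeff [:0, 1:] i \<in> (\<int> :: complex set)" by (auto simp: coeff_pCons split: nat.split)
  then have "(poly [:0, 1:] \<epsilon>, poly [:0, 1:] 0) \<in> R0" unfolding R0_def by blast
  then have \<epsilon>R: "(\<epsilon>, 0) \<in> R" using R0 by auto
  have "\<epsilon> \<noteq> 0" using \<epsilon> by auto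
  have deriv0: "deriv3 (Y0 0) Y1 Y2 F = D0 F" for F
  proof
    fix e show "deriv3 (Y0 0) Y1 Y2 F e = D0 F e" by (cases e) (simp add: deriv3_Y)
  qed
  have deriv_pscale: "deriv3 (Y0 \<epsilon>) Y1 Y2 (pscale k F) = pscale k (deriv3 (Y0 \<epsilon>) Y1 Y2 F)" for k F
    by (rule deriv3_pscale)
  have "\<not> admits_invariant_curve l0 l1 l2 (rform l0 l1 l2 (Y0 \<epsilon>) Y1 Y2)"
  proof
    assume "admits_invariant_curve l0 l1 l2 (rform l0 l1 l2 (Y0 \<epsilon>) Y1 Y2)"
    then obtain n F where n: "n > 0" and F: "quasi_hom l0 l1 l2 (int n) F" "F \<noteq> (\<lambda>_. 0)"
      and inv: "invariant_curve (rform l0 l1 l2 (Y0 \<epsilon>) Y1 Y2) F"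
      unfolding admits_invariant_curve_def by blast
    have "\<exists>L. is_poly L \<and> deriv3 (Y0 \<epsilon>) Y1 Y2 F = pmul F L"
      by (rule ex_cofactor[OF _ _ is_poly_pscale[OF is_poly_monomial] F inv]) (use l in auto)
    then obtain L where L: "is_poly L" "deriv3 (Y0 \<epsilon>) Y1 Y2 F = pmul F L" by blast
    have polyF: "is_poly F" using F by (simp add: quasi_hom_def)
    obtain \<mu> F' where \<mu>: "\<mu> \<noteq> 0" and F'0: "F' \<noteq> (\<lambda>_. 0)"
      and F': "reduces R (pscale (inverse \<mu>) F) F'"
      using ex_primitive_multiple[OF R polyF F(2)] by blast
    define F1 where "F1 = pscale (inverse \<mu>) F"
    have F1: "quasi_hom l0 l1 l2 (int n) F1" "reduces R F1 F'" "deriv3 (Y0 \<epsilon>) Y1 Y2 F1 = pmul F1 L"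
      using F F' L(2) by (simp_all add: F1_def quasi_hom_pscale deriv_pscale pmul_pscale_left)
    have "reduces R (pmul F1 L) (D0 F')"
      using reduces_deriv3_Y[OF h F1(2) \<epsilon>R] by (simp add: F1(3) deriv0)
    then obtain L' where L': "reduces R L L'" using gauss_lemma[OF R F1(2) F'0 L(1)] by blast
    have eigen: "D0 F' = pmul F' L'"
      using reduces_unique[OF h \<open>reduces R (pmul F1 L) (D0 F')\<close> reduces_pmul[OF h F1(2) L']] .
    have qF': "quasi_hom l0 l1 l2 (int n) F'" by (rule quasi_hom_reduces[OF h F1(2,1)])
    have pL': "is_poly L'" by (rule is_poly_reduces[OF h L' L(1)])
    note F'_supp = no_x1[OF qF' F'0 pL' eigen] no_x2[OF qF' F'0 pL' eigen]
    obtain x where "F' x \<noteq> 0" using F'0 by blast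
    moreover obtain K j k where "x = (K, j, k)" by (metis prod_cases3)
    ultimately have FK: "F' (K, 0, 0) \<noteq> 0" using F'_supp by blast
    then have nK: "n = l0 * K" using qF' unfolding quasi_hom_def wdeg_def by fastforce
    then have K: "0 < K" using n by simp
    have F'_mono: "F' e = 0" if "e \<noteq> (K, 0, 0)" for e
    proof (rule ccontr)
      assume "F' e \<noteq> 0"
      moreover obtain i j k where e: "e = (i, j, k)" by (metis prod_cases3)
      ultimately have "j = 0" "k = 0" "F' (i, 0, 0) \<noteq> 0" using F'_supp by blast+
      then show False using F_unique[OF qF' F'0 pL' eigen FK] that e by blast
    qed
    \<comment> \<open>\<open>D0\<close> has no \<open>\<partial>0\<close>-part and kills powers of
      x0. Hence the cofactor reduces to 0, and below its product with the rescaled deviation drops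
      out.\<close>
    have "D0 F' = (\<lambda>_. 0)"
    proof
      fix e :: "nat \<times> nat \<times> nat"
      obtain i j k where e: "e = (i, j, k)" by (metis prod_cases3)
      have "of_nat (alpha (j - p) (k - q)) * F' (i, j - p, k - q) = 0"
        using F'_mono by (cases "j - p = 0 \<and> k - q = 0") (auto simp: alpha_def)
      then show "D0 F' e = 0" using F'_mono by (simp add: e D0_def)
    qed
    then have "pmul F' L' = (\<lambda>_. 0)" using eigen by simp
    then have "L' = (\<lambda>_. 0)" using F'0 pmul_eq_0_iff by blast
    then have L0: "reduces R L (\<lambda>_. 0)" using L' by simp
    define a where "a = F1 (K, 0, 0)"
    have aR: "(a, F' (K, 0, 0)) \<in> R" using F1(2) by (simp add: a_def reduces_def)
    then have a0: "a \<noteq> 0" using FK partial_hom_0D[OF h] by blast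
    \<comment> \<open>With the coefficient of x0^K normalized to 1, \<open>F3\<close> is the
      deviation from x0^K and has no such term.\<close>
    define F2 where "F2 = pscale (inverse a) F1"
    define F3 where "F3 = psub F2 (monomial (K, 0, 0))"
    have q3: "quasi_hom l0 l1 l2 (int n) F3"
      using quasi_hom_monomial[of l0 K l1 0 l2 0 0 n] nK F1(1)
      by (simp add: F3_def F2_def quasi_hom_psub quasi_hom_pscale)
    have F3K: "F3 (K, 0, 0) = 0" using a0 by (simp add: F3_def F2_def a_def psub_def pscale_def monomial_def)
    have F2: "deriv3 (Y0 \<epsilon>) Y1 Y2 F2 = pmul F2 L"
      by (simp add: F2_def deriv_pscale F1(3) pmul_pscale_left)
    \<comment> \<open>Including \<epsilon> makes both the rescaled deviation \<open>F4\<close> and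
      \<epsilon> / \<nu> finite, whichever of the two is larger.\<close>
    have fin: "finite (insert \<epsilon> (F3 ` {e. F3 e \<noteq> 0}))"
      using q3 by (simp add: quasi_hom_def is_poly_def)
    obtain \<nu> where \<nu>: "\<nu> \<in> insert \<epsilon> (F3 ` {e. F3 e \<noteq> 0})" "\<nu> \<noteq> 0"
      "\<forall>x\<in>insert \<epsilon> (F3 ` {e. F3 e \<noteq> 0}). \<exists>t. (x / \<nu>, t) \<in> R"
      using max_hom_normalize[OF R fin] \<open>\<epsilon> \<noteq> 0\<close> by blast
    obtain c where c: "(\<epsilon> / \<nu>, c) \<in> R" using \<nu>(3) by blast
    define F4 where "F4 = pscale (inverse \<nu>) F3"
    have "\<exists>t. (F4 e, t) \<in> R" for e
    proof (cases "F3 e = 0")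
      case True
      then show ?thesis using partial_hom_zero[OF h] by (auto simp: F4_def pscale_def)
    next
      case False
      then have "F3 e \<in> insert \<epsilon> (F3 ` {e. F3 e \<noteq> 0})" by blast
      then have "\<exists>t. (F3 e / \<nu>, t) \<in> R" using \<nu>(3) by blast
      then show ?thesis by (simp add: F4_def pscale_def divide_inverse mult.commute)
    qed
    then obtain G where "\<And>e. (F4 e, G e) \<in> R" by metis
    then have G: "reduces R F4 G" by (simp add: reduces_def)
    have q4: "quasi_hom l0 l1 l2 (int n) F4" unfolding F4_def by (rule quasi_hom_pscale[OF q3])
    have G0: "G = (\<lambda>_. 0) \<and> c * of_nat K = 0"
    proof (rule D0_first_order[OF _ _ K])
      show "quasi_hom l0 l1 l2 (int (l0 * K)) G" using quasi_hom_reduces[OF h G q4] nK by simp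
      have "(F4 (K, 0, 0), G (K, 0, 0)) \<in> R" using G by (simp add: reduces_def)
      then show "G (K, 0, 0) = 0" using F3K partial_hom_0D[OF h] by (simp add: F4_def pscale_def)
      fix i j k assume iK: "i < K"
      have lhs: "(\<epsilon> / \<nu> * of_nat K * (if (i, j, k) = (K - 1, u, v) then 1 else 0) + deriv3 (Y0 \<epsilon>) Y1 Y2 F4 (i, j, k),
          c * of_nat K * (if (i, j, k) = (K - 1, u, v) then 1 else 0) + D0 G (i, j, k)) \<in> R"
        using reduces_deriv3_Y[OF h G \<epsilon>R] partial_hom_one[OF h] partial_hom_zero[OF h]
        unfolding deriv0 reduces_def
        by (intro partial_hom_add[OF h] partial_hom_mult[OF h] c partial_hom_of_nat[OF h]) auto
      have rhs: "(pmul F4 L (i, j, k), 0) \<in> R"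
      proof -
        have "pmul G (\<lambda>_. 0) = (\<lambda>_. 0)" by (simp add: pmul_eq_0_iff)
        then show ?thesis using reduces_pmul[OF h G L0] by (simp add: reduces_def)
      qed
      \<comment> \<open>The size of \<open>L\<close> relative to \<nu> is unknown, but x0^K
        \<open>L\<close> does not contribute in x0-degree below \<open>K\<close>; hence the
        comparison is restricted to \<open>i < K\<close>.\<close>
      have "F2 = padd (monomial (K, 0, 0)) F3" by (auto simp: F3_def padd_def psub_def)
      then have "pmul F2 L (i, j, k) = pmul F3 L (i, j, k)"
        using iK by (simp add: pmul_padd_left padd_def[of "pmul _ _"] pmul_monomial)
      moreover have "deriv3 (Y0 \<epsilon>) Y1 Y2 F2 (i, j, k)
          = deriv3 (Y0 \<epsilon>) Y1 Y2 F3 (i, j, k) + deriv3 (Y0 \<epsilon>) Y1 Y2 (monomial (K, 0, 0)) (i, j, k)"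
        unfolding \<open>F2 = padd (monomial (K, 0, 0)) F3\<close> deriv3_Y D0_def prod.case padd_def
        by (simp add: algebra_simps)
      moreover have "deriv3 (Y0 \<epsilon>) Y1 Y2 (monomial (K, 0, 0)) (i, j, k)
          = \<epsilon> * of_nat K * (if (i, j, k) = (K - 1, u, v) then 1 else 0)"
      proof -
        have "D0 (monomial (K, 0, 0)) (i, j, k) = 0" using iK by (simp add: D0_def monomial_def)
        moreover have "(if u \<le> j \<and> v \<le> k then of_nat (i + 1) * monomial (K, 0, 0) (i + 1, j - u, k - v) else 0)
            = of_nat K * (if (i, j, k) = (K - 1, u, v) then 1 else 0)"
          using K by (cases "i + 1 = K") (auto simp: monomial_def)
        ultimately show ?thesis by (simp only: deriv3_Y add_0_left mult.assoc)
      qed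
      ultimately have "\<epsilon> * of_nat K * (if (i, j, k) = (K - 1, u, v) then 1 else 0)
          + deriv3 (Y0 \<epsilon>) Y1 Y2 F3 (i, j, k) = pmul F3 L (i, j, k)"
        using F2 by (simp add: add.commute)
      moreover have "deriv3 (Y0 \<epsilon>) Y1 Y2 F4 e = deriv3 (Y0 \<epsilon>) Y1 Y2 F3 e / \<nu>"
        "pmul F4 L e = pmul F3 L e / \<nu>" for e
        unfolding F4_def deriv_pscale pmul_pscale_left
        by (simp_all add: pscale_def[of "inverse \<nu>"] divide_inverse)
      ultimately have "\<epsilon> / \<nu> * of_nat K * (if (i, j, k) = (K - 1, u, v) then 1 else 0)
          + deriv3 (Y0 \<epsilon>) Y1 Y2 F4 (i, j, k) = pmul F4 L (i, j, k)"
        by (metis add_divide_distrib times_divide_eq_left)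
      then show "c * of_nat K * (if (i, j, k) = (K - 1, u, v) then 1 else 0) + D0 G (i, j, k) = 0"
        using partial_hom_unique[OF h lhs] rhs by simp
    qed
    then have c0: "c = 0" using K by simp
    \<comment> \<open>\<nu> is \<epsilon> or a coefficient of \<open>F3\<close>, and all of these
      divided by \<nu> have just been shown to reduce to 0.\<close>
    have "(\<nu> / \<nu>, 0) \<in> R"
    proof (cases "\<nu> = \<epsilon>")
      case True
      then show ?thesis using c c0 by simp
    next
      case False
      then obtain e where "\<nu> = F3 e" using \<nu>(1) by blast
      then have "F4 e = \<nu> / \<nu>" by (simp only: F4_def pscale_def divide_inverse mult.commute)
      moreover have "G e = 0" using G0 by simp
      moreover have "(F4 e, G e) \<in> R" using G unfolding reduces_def by blast
      ultimately show ?thesis by (simp only:)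
    qed
    then have "(1, 0) \<in> R" using \<nu>(2) by simp
    then show False using partial_hom_unique[OF h partial_hom_one[OF h]] by force
  qed
  then show ?thesis using rform_in_FolSpace by blast
qed

end

section \<open>Existence of suitable exponents\<close>

text \<open>\<open>y\<close> is the residue of N / b modulo a, so \<open>b * y\<close> is at most
  \<open>b * (a - 1)\<close>, hence at most \<open>N\<close>, and a divides the rest.\<close>

lemma ex_two_coin_representation:
  fixes a b N :: nat
  assumes "coprime a b" "0 < a" "0 < b" and N: "a * b \<le> N + b"
  obtains x y where "a * x + b * y = N" "y < a"
proof -
  obtain z w where "b * z = a * w + 1" using bezout_nat[of b a] assms(1,3) by (auto simp: gcd.commute)
  then have "b * (z * N) = a * (w * N) + N" by (metis add_mult_distrib mult.assoc mult_1)
  then have z: "b * (z * N mod a) mod a = N mod a" by (simp add: mod_mult_right_eq)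
  define y where "y = z * N mod a"
  have y: "y < a" using assms(2) by (simp add: y_def)
  then have "b * (y + 1) \<le> b * a" by (intro mult_le_mono2) simp
  then have le: "b * y \<le> N" using N by (simp add: mult.commute)
  have "N mod a = b * y mod a" using z by (simp add: y_def)
  then have "a dvd N - b * y" using mod_eq_dvd_iff_nat[OF le] by blast
  then obtain x where "N - b * y = a * x" by (elim dvdE)
  then show thesis using that[of x y] y le by simp
qed

text \<open>Choosing \<open>q < l1\<close> makes \<open>p\<close> large: the bound on d yields
  \<open>l0 \<le> p\<close> and \<open>l0 * l2 < l1 * p + l1\<close>, which leave room for the
  remaining exponents.\<close>

lemma ex_special_field:
  fixes l0 l1 l2 d :: nat
  assumes l: "1 \<le> l0" "l0 \<le> l1" "l1 \<le> l2"
    and co: "coprime l0 l1" "coprime l0 l2" "coprime l1 l2"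
    and d: "l0 * l1 * l2 + l0 * l1 + 2 * l2 \<le> d"
  shows "\<exists>m p q s1 t1 s2 t2 u v. special_field l0 l1 l2 m p q s1 t1 s2 t2 u v \<and> d = m + l0 + l1 + l2"
proof -
  define m where "m = d - l0 - l1 - l2"
  have mul: "l0 \<le> l0 * l1" "l1 \<le> l0 * l1" "l1 * l2 \<le> l0 * l1 * l2" "l0 * l2 \<le> l1 * l2" "l2 \<le> l1 * l2"
    using l by (auto simp: mult.assoc)
  have dm: "d = m + l0 + l1 + l2" unfolding m_def using d l mul by linarith
  obtain p q where pq: "l1 * p + l2 * q = m" "q < l1"
    using ex_two_coin_representation[of l1 l2 m] co(3) l d mul dm by auto
  have "l2 * (q + 1) \<le> l2 * l1" using pq(2) by (intro mult_le_mono2) simp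
  then have l1p: "l0 * l1 * l2 + l0 * l1 + 2 * l2 \<le> l1 * p + l1 * l2 + l0 + l1"
    using pq(1) d dm by (simp add: mult.commute)
  then have "l0 * l1 \<le> l1 * p" using mul l by linarith
  then have p: "l0 \<le> p" using l by (simp add: mult.commute)
  \<comment> \<open>For \<open>l0 = 1\<close> the triple product in \<open>l1p\<close> cancels
    against \<open>l1 * l2\<close>, and the summand \<open>2 * l2\<close> of the bound has to
    suffice.\<close>
  have big: "l0 * l2 < l1 * p + l1"
  proof (cases "l0 = 1")
    case True
    then show ?thesis using l1p l by simp
  next
    case False
    then have "2 * (l1 * l2) \<le> l0 * (l1 * l2)" using l by (intro mult_le_mono1) simp
    then show ?thesis using l1p mul l unfolding mult.assoc by linarith
  qed
  \<comment> \<open>The ansatz \<open>t1 = q + 1 + y\<close> builds in \<open>q < t1\<close>; the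
    right-hand side is \<open>m + l1 - l2 * (q + 1)\<close>.\<close>
  have "l0 * l2 \<le> l1 * p + l1 - l2 + l2" using big by linarith
  then obtain s1 y where y: "l0 * s1 + l2 * y = l1 * p + l1 - l2" "y < l0"
    using ex_two_coin_representation[of l0 l2 "l1 * p + l1 - l2"] co(2) l by auto
  have "l2 * (y + 1) \<le> l2 * l0" using y(2) by (intro mult_le_mono2) simp
  then have lt: "l2 * y + l2 < l1 * p + l1" using big by (simp add: mult.commute)
  have s1: "1 \<le> s1"
  proof (rule ccontr)
    assume "\<not> 1 \<le> s1"
    then have "s1 = 0" by simp
    then have "l2 * y = l1 * p + l1 - l2" using y(1) by simp
    then show False using lt by linarith
  qed
  have "l0 * s1 + l2 * y + l2 = l1 * p + l1" using y(1) lt by linarith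
  then have t1: "l0 * s1 + l2 * (q + 1 + y) = m + l1"
    using pq(1) by (simp add: algebra_simps)
  have "l0 * l1 \<le> m + l2 + l1" using l1p pq(1) mul l by linarith
  then obtain s2 t2 where s2: "l0 * s2 + l1 * t2 = m + l2" "t2 < l0"
    using ex_two_coin_representation[of l0 l1 "m + l2"] co(1) l by auto
  have t2: "t2 < p" using s2(2) p by simp
  have "1 \<le> s2"
  proof (rule ccontr)
    assume "\<not> 1 \<le> s2"
    then have "s2 = 0" by simp
    then have "l1 * t2 = m + l2" using s2(1) by simp
    moreover have "l1 * t2 \<le> l1 * p" using t2 by (intro mult_le_mono2) simp
    ultimately show False using pq(1) l by simp
  qed
  \<comment> \<open>The roles of the coins are swapped here so that it is \<open>u\<close> that gets
    bounded.\<close>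
  have "l2 * l1 \<le> m + l0 + l1" using d dm mul l unfolding mult.commute[of l2 l1] by linarith
  then obtain v u where u: "l2 * v + l1 * u = m + l0" "u < l2"
    using ex_two_coin_representation[of l2 l1 "m + l0"] co(3) l by (auto simp: coprime_commute)
  have "\<not> (p \<le> u \<and> q \<le> v)"
  proof
    assume "p \<le> u \<and> q \<le> v"
    \<comment> \<open>The quotient monomial would have degree \<open>l0\<close>, which forces
      \<open>l0 = l1 = 1\<close>. Then \<open>q = 0\<close> and
      \<open>p = m \<ge> l2 > u\<close>.\<close>
    then obtain u' v' where uv: "u = p + u'" "v = q + v'" using le_Suc_ex by blast
    then have l0: "l1 * u' + l2 * v' = l0" using u(1) pq(1) by (simp add: algebra_simps)
    have "l1 \<le> l0"
    proof (cases "u' = 0")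
      case True
      then have "v' \<noteq> 0" using l0 l by auto
      then have "l2 \<le> l2 * v'" by simp
      then show ?thesis using l0 l by linarith
    next
      case False
      then have "l1 \<le> l1 * u'" by simp
      then show ?thesis using l0 by linarith
    qed
    then have "l0 = 1" "l1 = 1" using l co(1) by auto
    then show False using pq u(2) uv(1) d dm by simp
  qed
  then have "special_field l0 l1 l2 m p q s1 (q + 1 + y) s2 t2 u v"
    using l pq s1 t1 \<open>1 \<le> s2\<close> t2 s2 u by unfold_locales (auto simp: add.commute)
  then show ?thesis using dm by blast
qed

section \<open>Generic one-forms\<close>

text \<open>Integer polynomials in the coefficients of a one-form: countably many, and closed under the
  ring operations.\<close>

datatype expr = Num int | Coord nat "nat \<times> nat \<times> nat" | Plus expr expr | Times expr expr

instance expr :: countable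
  by countable_datatype

primrec expr_val :: "form1 \<Rightarrow> expr \<Rightarrow> complex" where
  "expr_val \<omega> (Num z) = of_int z"
| "expr_val \<omega> (Coord i e) = comp i \<omega> e"
| "expr_val \<omega> (Plus a b) = expr_val \<omega> a + expr_val \<omega> b"
| "expr_val \<omega> (Times a b) = expr_val \<omega> a * expr_val \<omega> b"

lemma comp_fscale: "comp i (fscale c \<omega>) = pscale c (comp i \<omega>)"
  by (simp add: comp_def fscale_def)

lemma fscale_fscale: "fscale b (fscale c \<omega>) = fscale (b * c) \<omega>"
  by (simp add: fscale_def pscale_def mult.assoc)

lemma fscale_one: "fscale 1 \<omega> = \<omega>"
  by (simp add: fscale_def pscale_def)

lemma fscale_FolSpace:
  assumes "\<omega> \<in> FolSpace l0 l1 l2 d" shows "fscale c \<omega> \<in> FolSpace l0 l1 l2 d"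
proof -
  have "contrR l0 l1 l2 (fscale c \<omega>) = pscale c (contrR l0 l1 l2 \<omega>)"
    by (simp add: contrR_def comp_fscale fps3_simps algebra_simps flip: fps3_inject)
  then show ?thesis
    using assms by (auto simp: FolSpace_def comp_fscale intro: quasi_hom_pscale) (simp add: pscale_def)
qed

lemma expr_val_fscale_polyfun: "(\<lambda>\<omega>. expr_val (fscale c \<omega>) x) \<in> polyfun"
  by (induction x) (auto simp: comp_fscale pscale_def intro: polyfun.intros)

lemma expr_val_fscale_poly: "\<exists>P. \<forall>c. expr_val (fscale c \<omega>) x = poly P c"
proof (induction x)
  case (Num z)
  show ?case by (intro exI[of _ "[:of_int z:]"]) simp
next
  case (Coord i e)
  show ?case by (intro exI[of _ "[:0, comp i \<omega> e:]"]) (simp add: comp_fscale pscale_def)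
next
  case (Plus a b)
  then show ?case by (metis expr_val.simps(3) poly_add)
next
  case (Times a b)
  then show ?case by (metis expr_val.simps(4) poly_mult)
qed

text \<open>Along the line through \<omega> each expression is a polynomial in c with finitely many
  roots, and there are only countably many expressions. Scaling matters because integer polynomials
  need not be homogeneous.\<close>

lemma ex_generic_multiple:
  assumes "\<And>x. x \<in> X \<Longrightarrow> \<exists>c. expr_val (fscale c \<omega>) x \<noteq> 0"
  shows "\<exists>c. c \<noteq> 0 \<and> (\<forall>x\<in>X. expr_val (fscale c \<omega>) x \<noteq> 0)"
proof -
  have "countable (\<Union>x\<in>X. {c. expr_val (fscale c \<omega>) x = 0})"
  proof (intro countable_UN countableI_type countable_finite)
    fix x assume "x \<in> X"
    obtain P where P: "\<And>c. expr_val (fscale c \<omega>) x = poly P c" using expr_val_fscale_poly by blast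
    then have "P \<noteq> 0" using assms[OF \<open>x \<in> X\<close>] by force
    then show "finite {c. expr_val (fscale c \<omega>) x = 0}" unfolding P by (rule poly_roots_finite)
  qed
  then have "countable (insert 0 (\<Union>x\<in>X. {c. expr_val (fscale c \<omega>) x = 0}))" by simp
  then have "insert 0 (\<Union>x\<in>X. {c. expr_val (fscale c \<omega>) x = 0}) \<noteq> UNIV"
    using uncountable_UNIV_complex by metis
  then obtain c where "c \<notin> insert 0 (\<Union>x\<in>X. {c. expr_val (fscale c \<omega>) x = 0})" by blast
  then show ?thesis by (intro exI[of _ c]) auto
qed

definition generic_in :: "form1 set \<Rightarrow> form1 \<Rightarrow> bool" where
  "generic_in V \<omega> \<longleftrightarrow> (\<forall>x. expr_val \<omega> x = 0 \<longrightarrow> (\<forall>\<omega>'\<in>V. expr_val \<omega>' x = 0))"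

lemma partial_hom_specialization:
  assumes "generic_in V \<omega>" "\<omega>' \<in> V"
  shows "partial_hom {(expr_val \<omega> x, expr_val \<omega>' x) | x. True}" (is "partial_hom ?R")
  unfolding partial_hom_def
proof (intro conjI allI impI)
  have "(expr_val \<omega> (Num 1), expr_val \<omega>' (Num 1)) \<in> ?R" by blast
  then show "(1, 1) \<in> ?R" by simp
  fix a b c d assume "(a, b) \<in> ?R" "(c, d) \<in> ?R"
  then obtain x y where xy: "a = expr_val \<omega> x" "b = expr_val \<omega>' x" "c = expr_val \<omega> y" "d = expr_val \<omega>' y" by blast
  have "(expr_val \<omega> (Plus x (Times (Num (-1)) y)), expr_val \<omega>' (Plus x (Times (Num (-1)) y))) \<in> ?R" by blast
  then show "(a - c, b - d) \<in> ?R" by (simp add: xy)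
  have "(expr_val \<omega> (Times x y), expr_val \<omega>' (Times x y)) \<in> ?R" by blast
  then show "(a * c, b * d) \<in> ?R" by (simp add: xy)
next
  fix b assume "(0, b) \<in> ?R"
  then obtain x where "0 = expr_val \<omega> x" "b = expr_val \<omega>' x" by blast
  then show "b = 0" using assms unfolding generic_in_def by metis
qed

lemma generic_specialization:
  assumes gen: "generic_in V \<omega>" "\<omega>' \<in> V" and inv: "admits_invariant_curve l0 l1 l2 \<omega>"
  shows "admits_invariant_curve l0 l1 l2 \<omega>'"
proof -
  obtain R where R0: "{(expr_val \<omega> x, expr_val \<omega>' x) | x. True} \<subseteq> R" and R: "max_hom R"
    using ex_max_hom[OF partial_hom_specialization[OF gen]] by blast
  note h = max_hom_imp_partial_hom[OF R]
  have \<omega>R: "reduces R (comp i \<omega>) (comp i \<omega>')" for i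
    unfolding reduces_def
  proof
    fix e
    have "(expr_val \<omega> (Coord i e), expr_val \<omega>' (Coord i e)) \<in> R" using R0 by blast
    then show "(comp i \<omega> e, comp i \<omega>' e) \<in> R" by simp
  qed
  obtain n F where n: "n > 0" and F: "quasi_hom l0 l1 l2 (int n) F" "F \<noteq> (\<lambda>_. 0)"
    and "invariant_curve \<omega> F" using inv unfolding admits_invariant_curve_def by blast
  then obtain T01 T02 T12 where T: "is_poly T01" "is_poly T02" "is_poly T12"
    "psub (pmul (comp 0 \<omega>) (dx1 F)) (pmul (comp 1 \<omega>) (dx0 F)) = pmul F T01"
    "psub (pmul (comp 0 \<omega>) (dx2 F)) (pmul (comp 2 \<omega>) (dx0 F)) = pmul F T02"
    "psub (pmul (comp 1 \<omega>) (dx2 F)) (pmul (comp 2 \<omega>) (dx1 F)) = pmul F T12"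
    unfolding invariant_curve_def by blast
  have "is_poly F" using F by (simp add: quasi_hom_def)
  then obtain \<mu> F' where F': "reduces R (pscale (inverse \<mu>) F) F'" "F' \<noteq> (\<lambda>_. 0)"
    using ex_primitive_multiple[OF R _ F(2)] by blast
  define F1 where "F1 = pscale (inverse \<mu>) F"
  note F'1 = F'(1)[folded F1_def]
  have dx: "dx0 F1 = pscale (inverse \<mu>) (dx0 F)" "dx1 F1 = pscale (inverse \<mu>) (dx1 F)"
    "dx2 F1 = pscale (inverse \<mu>) (dx2 F)"
    by (auto simp: F1_def dx0_def dx1_def dx2_def pscale_def)
  have scale: "psub (pscale k A) (pscale k B) = pscale k (psub A B)" for k A B
    by (simp add: psub_def pscale_def right_diff_distrib)
  have T1: "psub (pmul (comp 0 \<omega>) (dx1 F1)) (pmul (comp 1 \<omega>) (dx0 F1)) = pmul F1 T01"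
    "psub (pmul (comp 0 \<omega>) (dx2 F1)) (pmul (comp 2 \<omega>) (dx0 F1)) = pmul F1 T02"
    "psub (pmul (comp 1 \<omega>) (dx2 F1)) (pmul (comp 2 \<omega>) (dx1 F1)) = pmul F1 T12"
    unfolding dx pmul_pscale_right scale T unfolding F1_def pmul_pscale_left by (rule refl)+
  have red: "\<exists>T'. is_poly T' \<and> psub (pmul (comp i \<omega>') G') (pmul (comp j \<omega>') H') = pmul F' T'"
    if T: "is_poly T" and eq: "psub (pmul (comp i \<omega>) G) (pmul (comp j \<omega>) H) = pmul F1 T"
      and GH: "reduces R G G'" "reduces R H H'" for i j T G H G' H'
  proof -
    have *: "reduces R (pmul F1 T) (psub (pmul (comp i \<omega>') G') (pmul (comp j \<omega>') H'))"
      unfolding eq[symmetric] by (intro reduces_psub[OF h] reduces_pmul[OF h] \<omega>R GH)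
    then obtain T' where T': "reduces R T T'" using gauss_lemma[OF R F'1 F'(2) T *] by blast
    then show ?thesis
      using reduces_unique[OF h * reduces_pmul[OF h F'1 T']] is_poly_reduces[OF h T' T] by blast
  qed
  have "invariant_curve \<omega>' F'"
    using red[OF T(1) T1(1) reduces_dx(2,1)[OF h F'1]] red[OF T(2) T1(2) reduces_dx(3,1)[OF h F'1]]
      red[OF T(3) T1(3) reduces_dx(3,2)[OF h F'1]]
    unfolding invariant_curve_def by blast
  moreover have "quasi_hom l0 l1 l2 (int n) F'"
    by (rule quasi_hom_reduces[OF h F'(1) quasi_hom_pscale[OF F(1)]])
  ultimately show ?thesis using n F'(2) unfolding admits_invariant_curve_def by blast
qed

lemma admits_invariant_curve_fscale:
  assumes "admits_invariant_curve l0 l1 l2 \<omega>"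
  shows "admits_invariant_curve l0 l1 l2 (fscale c \<omega>)"
proof -
  obtain n F T01 T02 T12 where n: "n > 0" "quasi_hom l0 l1 l2 (int n) F" "F \<noteq> (\<lambda>_. 0)"
    and T: "is_poly T01" "is_poly T02" "is_poly T12"
    "psub (pmul (comp 0 \<omega>) (dx1 F)) (pmul (comp 1 \<omega>) (dx0 F)) = pmul F T01"
    "psub (pmul (comp 0 \<omega>) (dx2 F)) (pmul (comp 2 \<omega>) (dx0 F)) = pmul F T02"
    "psub (pmul (comp 1 \<omega>) (dx2 F)) (pmul (comp 2 \<omega>) (dx1 F)) = pmul F T12"
    using assms unfolding admits_invariant_curve_def invariant_curve_def by blast
  have scale: "psub (pscale k A) (pscale k B) = pscale k (psub A B)" for k A B
    by (simp add: psub_def pscale_def right_diff_distrib)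
  have "invariant_curve (fscale c \<omega>) F"
    unfolding invariant_curve_def
    by (rule exI[of _ "pscale c T01"], rule exI[of _ "pscale c T02"], rule exI[of _ "pscale c T12"])
      (simp only: comp_fscale pmul_pscale_left pmul_pscale_right scale T is_poly_pscale simp_thms)
  then show ?thesis using n unfolding admits_invariant_curve_def by blast
qed

lemma admits_invariant_curve_zero:
  assumes "0 < l0"
  shows "admits_invariant_curve l0 l1 l2 (\<lambda>_. 0, \<lambda>_. 0, \<lambda>_. 0)"
proof -
  let ?F = "monomial (1, 0, 0)"
  have "quasi_hom l0 l1 l2 (int l0) ?F"
    unfolding quasi_hom_def wdeg_def by (auto simp: is_poly_monomial) (auto simp: monomial_def split: if_splits)
  moreover have "?F \<noteq> (\<lambda>_. 0)" by (auto simp: monomial_def fun_eq_iff)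
  moreover have "invariant_curve (\<lambda>_. 0, \<lambda>_. 0, \<lambda>_. 0) ?F"
    unfolding invariant_curve_def
    by (intro exI[of _ "\<lambda>_. 0"]) (auto simp: is_poly_def comp_def fps3_simps simp flip: fps3_inject)
  ultimately show ?thesis using assms unfolding admits_invariant_curve_def by blast
qed

theorem generic_no_invariant_curve:
  assumes l: "0 < l0" and V: "V = FolSpace l0 l1 l2 d"
    and ex: "\<omega>0 \<in> V" "\<not> admits_invariant_curve l0 l1 l2 \<omega>0"
  shows "\<exists>Z :: nat \<Rightarrow> form1 set.
      (\<forall>k. zariski_closed_cone V (Z k) \<and> proper_in_proj V (Z k)) \<and>
      (\<forall>\<omega>\<in>V. admits_invariant_curve l0 l1 l2 \<omega> \<longrightarrow> (\<exists>k. \<omega> \<in> Z k))"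
proof -
  define vanish where "vanish x \<longleftrightarrow> (\<forall>\<omega>\<in>V. expr_val \<omega> x = 0)" for x
  \<comment> \<open>The zero set of \<open>x\<close> need not be a cone; this is the largest subset
    of it in \<open>V\<close> that is stable under scaling.\<close>
  define W where "W x = {\<omega> \<in> V. \<forall>c. expr_val (fscale c \<omega>) x = 0}" for x
  \<comment> \<open>For an expression vanishing on all of \<open>V\<close> the cone would be
    \<open>V\<close>, which is not proper.\<close>
  define Z where "Z k = (if vanish (from_nat k) then {} else W (from_nat k))" for k
  have scale_V: "fscale c \<omega> \<in> V" if "\<omega> \<in> V" for c \<omega> using that fscale_FolSpace V by blast
  have \<omega>0: "\<omega>0 \<noteq> (\<lambda>_. 0, \<lambda>_. 0, \<lambda>_. 0)" using ex(2) admits_invariant_curve_zero[OF l] by blast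
  have cone: "zariski_closed_cone V (W x)" for x
    unfolding zariski_closed_cone_def
  proof (intro conjI exI[of _ "range (\<lambda>c \<omega>. expr_val (fscale c \<omega>) x)"] allI impI)
    show "range (\<lambda>c \<omega>. expr_val (fscale c \<omega>) x) \<subseteq> polyfun" using expr_val_fscale_polyfun by blast
    show "W x = {\<omega> \<in> V. \<forall>f\<in>range (\<lambda>c \<omega>. expr_val (fscale c \<omega>) x). f \<omega> = 0}" by (auto simp: W_def)
    show "fscale c \<omega> \<in> W x" if "\<omega> \<in> W x" for c \<omega>
      using that scale_V by (auto simp: W_def fscale_fscale)
  qed
  have proper: "proper_in_proj V (W x)" if x: "\<not> vanish x" for x
  proof -
    obtain \<omega> where \<omega>: "\<omega> \<in> V" "expr_val \<omega> x \<noteq> 0" using x unfolding vanish_def by blast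
    show ?thesis
    \<comment> \<open>Properness needs a nonzero witness. If only the zero form is at hand,
      \<omega>0 serves, since its line contains the zero form.\<close>
    proof (cases "\<omega> = (\<lambda>_. 0, \<lambda>_. 0, \<lambda>_. 0)")
      case True
      then have "fscale 0 \<omega>0 = \<omega>" by (simp add: fscale_def pscale_def)
      then have "\<omega>0 \<notin> W x" using \<omega>(2) by (auto simp: W_def)
      then show ?thesis using ex(1) \<omega>0 unfolding proper_in_proj_def by blast
    next
      case False
      have "\<omega> \<notin> W x" using \<omega>(2) fscale_one[of \<omega>] unfolding W_def by (metis (mono_tags, lifting) mem_Collect_eq)
      then show ?thesis using \<omega>(1) False unfolding proper_in_proj_def by blast
    qed
  qed
  have empty: "zariski_closed_cone V {}" "proper_in_proj V {}"
  proof -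
    have "{} = {\<omega> \<in> V. \<forall>f\<in>{\<lambda>_. 1 :: complex}. f \<omega> = 0}" by simp
    moreover have "{\<lambda>_. 1} \<subseteq> polyfun" by (simp add: pf_const)
    ultimately show "zariski_closed_cone V {}" unfolding zariski_closed_cone_def by blast
    show "proper_in_proj V {}" unfolding proper_in_proj_def using ex(1) \<omega>0 by blast
  qed
  have "\<exists>k. \<omega> \<in> Z k" if \<omega>: "\<omega> \<in> V" and inv: "admits_invariant_curve l0 l1 l2 \<omega>" for \<omega>
  proof (rule ccontr)
    assume no: "\<nexists>k. \<omega> \<in> Z k"
    have "\<exists>c. expr_val (fscale c \<omega>) x \<noteq> 0" if "x \<in> {x. \<not> vanish x}" for x
    proof -
      have "\<omega> \<notin> Z (to_nat x)" using no by blast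
      then show ?thesis using that \<omega> by (simp add: Z_def W_def)
    qed
    then obtain c where "\<forall>x\<in>{x. \<not> vanish x}. expr_val (fscale c \<omega>) x \<noteq> 0"
      using ex_generic_multiple by blast
    then have "generic_in V (fscale c \<omega>)" unfolding generic_in_def vanish_def by blast
    then show False
      using generic_specialization[OF _ ex(1) admits_invariant_curve_fscale[OF inv]] ex(2) by blast
  qed
  moreover have "zariski_closed_cone V (Z k) \<and> proper_in_proj V (Z k)" for k
    using cone proper empty by (simp add: Z_def)
  ultimately show ?thesis by blast
qed

theorem theoremA:
  fixes l0 l1 l2 d :: nat
  assumes "1 \<le> l0" and "l0 \<le> l1" and "l1 \<le> l2"
    and "coprime l0 l1" and "coprime l0 l2" and "coprime l1 l2"
    and "d \<ge> l0 * l1 * l2 + l0 * l1 + 2 * l2"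
  shows "\<exists>Z :: nat \<Rightarrow> form1 set.
           (\<forall>k. zariski_closed_cone (FolSpace l0 l1 l2 (int d)) (Z k) \<and>
                proper_in_proj (FolSpace l0 l1 l2 (int d)) (Z k)) \<and>
           (\<forall>\<omega> \<in> FolSpace l0 l1 l2 (int d). \<omega> \<noteq> (\<lambda>_. 0, \<lambda>_. 0, \<lambda>_. 0) \<longrightarrow>
              admits_invariant_curve l0 l1 l2 \<omega> \<longrightarrow> (\<exists>k. \<omega> \<in> Z k))"
proof -
  obtain m p q s1 t1 s2 t2 u v where "special_field l0 l1 l2 m p q s1 t1 s2 t2 u v"
    and d: "d = m + l0 + l1 + l2"
    using ex_special_field[OF assms] by blast
  then obtain \<omega> where "\<omega> \<in> FolSpace l0 l1 l2 (int d)" "\<not> admits_invariant_curve l0 l1 l2 \<omega>"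
    using special_field.ex_no_invariant_curve by blast
  then show ?thesis
    using generic_no_invariant_curve[OF _ refl, of l0] assms(1) by fastforce
qed

end
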